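(* Let $n\ge 1$, let $X$ be the variety of complete systems $(p_1,\dots,p_n)$ of pairwise orthogonal rank $1$ projectors in $\mathbb{C}^n$, let $Y$ be the product of $n$ copies of the variety (coadjoint orbit) of rank $1$ projectors in $\mathbb{C}^n$, and let $\Omega^1X$ be the total space of the cotangent bundle of $X$. Identify $\Omega^1X$ with $\mu_T^{-1}(0)/T$, where $\mu_T^{-1}(0)=\{(g,A)\in\mathbf{GL}(n)\times\mathrm{Mat}_{n\times n}(\mathbb{C}):\ \mathrm{diag}(Ag)=0\}$, and let $\phi:\Omega^1X\to Y$ be the map sending the class of $(g,A)$ to $(r_1,\dots,r_n)$, where $$r_i=p_i(1+gA)=gq_ig^{-1}(1+gA),\qquad i=1,\dots,n.$$ Then $\phi$ is an open symplectic embedding.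
   Context: The base field is $\mathbb{C}$. A projector is an idempotent matrix (not necessarily Hermitian); projectors $p,q$ are orthogonal if $pq=qp=0$. Let $q_1,\dots,q_n$ be the projectors onto the coordinate axes of $\mathbb{C}^n$ (the diagonal matrix units), $G=\mathbf{GL}(n)$ and $T\subset G$ the torus of diagonal matrices. The map $g\mapsto(p_i=gq_ig^{-1})_i$ identifies $X$ with $G/T$. Cotangent vectors of $G$ are identified with matrices through the pairing $\mathrm{Tr}(AB)$ (tangent vectors at any $g$ being regarded as matrices $B$), so the cotangent bundle of $G$ is $\Omega^1G=G\times\mathrm{Mat}_{n\times n}(\mathbb{C})\ni(g,A)$, with symplectic form $\mathrm{Tr}\,\mathrm{d}A\,\mathrm{d}g$ (products of matrix-valued $1$-forms, with the matrix product and the wedge product). The torus $T$ acts by $t\cdot(g,A)=(gt^{-1},tA)$, with moment map $\mu_T(g,A)=\mathrm{diag}(Ag)$, the diagonal part of the matrix $Ag$. Symplectic reduction identifies $\Omega^1X$, with its canonical symplectic form, with $\mu_T^{-1}(0)/T$; the symplectic form $\omega_X$ is induced by $\mathrm{Tr}\,\mathrm{d}A\,\mathrm{d}g$. The map $\phi$ is well defined: the $r_i$ are invariant under $T$ and are rank $1$ projectors. The symplectic form on $Y$ is the sum of the standard coadjoint-orbit forms of the factors, $\omega_Y=\mathrm{Tr}\sum_i r_i\,\mathrm{d}r_i\,\mathrm{d}r_i$. "Open symplectic embedding" means an isomorphism onto a Zariski open subvariety of $Y$ with $\phi^*\omega_Y=\omega_X$. *)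

theory Defs
  imports "HOL-Analysis.Analysis"
begin

section \<open>Varieties as spaces with functions\<close>

text \<open>
  A variety over \<open>\<complex>\<close> is a topological space together with, for every open set \<open>U\<close>, the
  functions that are regular on \<open>U\<close>. Functions are total in HOL, so membership of \<open>f\<close> in
  \<open>reg M U\<close> only constrains the values of \<open>f\<close> on \<open>U\<close>.
\<close>

record 'a fspace =
  topo :: "'a topology"
  reg :: "'a set \<Rightarrow> ('a \<Rightarrow> complex) set"

abbreviation points :: "'a fspace \<Rightarrow> 'a set"
  where "points M \<equiv> topspace (topo M)"

text \<open>
  An affine space is a type with a chosen set \<open>X\<close> of coordinate functions;
  its polynomial functions form the \<open>\<complex>\<close>-algebra generated by \<open>X\<close>.
\<close>

inductive_set polynomials :: "('a \<Rightarrow> complex) set \<Rightarrow> ('a \<Rightarrow> complex) set"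
  for X :: "('a \<Rightarrow> complex) set"
  where
    coord: "f \<in> X \<Longrightarrow> f \<in> polynomials X"
  | const: "(\<lambda>_. c) \<in> polynomials X"
  | add: "f \<in> polynomials X \<Longrightarrow> g \<in> polynomials X \<Longrightarrow> (\<lambda>x. f x + g x) \<in> polynomials X"
  | mult: "f \<in> polynomials X \<Longrightarrow> g \<in> polynomials X \<Longrightarrow> (\<lambda>x. f x * g x) \<in> polynomials X"

definition zariski_open :: "('a \<Rightarrow> complex) set \<Rightarrow> 'a set \<Rightarrow> bool"
  where "zariski_open X U \<longleftrightarrow> (\<exists>P \<subseteq> polynomials X. - U = {x. \<forall>p\<in>P. p x = 0})"

definition zariski :: "('a \<Rightarrow> complex) set \<Rightarrow> 'a topology"
  where "zariski X = topology (zariski_open X)"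

lemma zariski_open_iff:
  "zariski_open X U \<longleftrightarrow> (\<forall>x\<in>U. \<exists>p\<in>polynomials X. p x \<noteq> 0 \<and> {y. p y \<noteq> 0} \<subseteq> U)"
proof
  assume "zariski_open X U"
  then obtain P where P: "P \<subseteq> polynomials X" "- U = {x. \<forall>p\<in>P. p x = 0}"
    unfolding zariski_open_def by blast
  show "\<forall>x\<in>U. \<exists>p\<in>polynomials X. p x \<noteq> 0 \<and> {y. p y \<noteq> 0} \<subseteq> U"
  proof
    fix x assume "x \<in> U"
    then have "\<not> (\<forall>p\<in>P. p x = 0)" using P(2) by blast
    then obtain p where "p \<in> P" "p x \<noteq> 0" by blast
    moreover have "{y. p y \<noteq> 0} \<subseteq> U" using P(2) \<open>p \<in> P\<close> by blast
    ultimately show "\<exists>p\<in>polynomials X. p x \<noteq> 0 \<and> {y. p y \<noteq> 0} \<subseteq> U" using P(1) by blast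
  qed
next
  assume *: "\<forall>x\<in>U. \<exists>p\<in>polynomials X. p x \<noteq> 0 \<and> {y. p y \<noteq> 0} \<subseteq> U"
  have "- U = {x. \<forall>p\<in>{p \<in> polynomials X. {y. p y \<noteq> 0} \<subseteq> U}. p x = 0}"
    using * by blast
  then show "zariski_open X U" unfolding zariski_open_def by blast
qed

lemma istopology_zariski_open: "istopology (zariski_open X)"
  unfolding istopology_def
proof (intro conjI allI impI)
  fix S T assume S: "zariski_open X S" and T: "zariski_open X T"
  show "zariski_open X (S \<inter> T)"
    unfolding zariski_open_iff
  proof
    fix x assume x: "x \<in> S \<inter> T"
    obtain p where p: "p \<in> polynomials X" "p x \<noteq> 0" "{y. p y \<noteq> 0} \<subseteq> S"
      using S x unfolding zariski_open_iff by blast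
    obtain q where q: "q \<in> polynomials X" "q x \<noteq> 0" "{y. q y \<noteq> 0} \<subseteq> T"
      using T x unfolding zariski_open_iff by blast
    show "\<exists>p\<in>polynomials X. p x \<noteq> 0 \<and> {y. p y \<noteq> 0} \<subseteq> S \<inter> T"
      by (rule bexI[OF _ polynomials.mult[OF p(1) q(1)]]) (use p q in auto)
  qed
next
  fix K assume K: "\<forall>U\<in>K. zariski_open X U"
  show "zariski_open X (\<Union>K)"
    unfolding zariski_open_iff
  proof
    fix x assume "x \<in> \<Union>K"
    then obtain U where "U \<in> K" "x \<in> U" by blast
    then obtain p where "p \<in> polynomials X" "p x \<noteq> 0" "{y. p y \<noteq> 0} \<subseteq> U"
      using K unfolding zariski_open_iff by blast
    then show "\<exists>p\<in>polynomials X. p x \<noteq> 0 \<and> {y. p y \<noteq> 0} \<subseteq> \<Union>K" using \<open>U \<in> K\<close> by blast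
  qed
qed

lemma openin_zariski: "openin (zariski X) U \<longleftrightarrow> zariski_open X U"
  unfolding zariski_def by (simp only: topology_inverse'[OF istopology_zariski_open])

lemma topspace_zariski [simp]: "topspace (zariski X) = UNIV"
proof -
  have "openin (zariski X) UNIV"
    unfolding openin_zariski zariski_open_iff
    by (auto intro: bexI[OF _ polynomials.const[of 1]])
  then show ?thesis by (simp add: openin_subset top.extremum_uniqueI)
qed

text \<open>The reduced structure on a locally closed subset \<open>S\<close> of an affine space.\<close>

definition subvariety :: "('a \<Rightarrow> complex) set \<Rightarrow> 'a set \<Rightarrow> 'a fspace"
  where "subvariety X S =
    \<lparr> topo = subtopology (zariski X) S,
      reg = (\<lambda>U. {f. \<forall>x\<in>U. \<exists>V p q.
        openin (subtopology (zariski X) S) V \<and> x \<in> V \<and> V \<subseteq> U \<and>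
        p \<in> polynomials X \<and> q \<in> polynomials X \<and>
        (\<forall>y\<in>V. q y \<noteq> 0 \<and> f y = p y / q y)}) \<rparr>"

definition open_subspace :: "'a fspace \<Rightarrow> 'a set \<Rightarrow> 'a fspace"
  where "open_subspace M W = \<lparr> topo = subtopology (topo M) W, reg = reg M \<rparr>"

text \<open>
  The quotient along a map \<open>\<pi>\<close>: the quotient topology, with the functions whose pullback is
  regular. When the fibres of \<open>\<pi>\<close> are the orbits of a group action, these are the invariant
  regular functions on saturated open sets.
\<close>

definition quotient_space :: "'a fspace \<Rightarrow> ('a \<Rightarrow> 'b) \<Rightarrow> 'b fspace"
  where "quotient_space M \<pi> =
    \<lparr> topo = topology (\<lambda>U. U \<subseteq> \<pi> ` points M \<and> openin (topo M) {x \<in> points M. \<pi> x \<in> U}),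
      reg = (\<lambda>U. {f. f \<circ> \<pi> \<in> reg M {x \<in> points M. \<pi> x \<in> U}}) \<rparr>"

lemma openin_quotient_space:
  "openin (topo (quotient_space M \<pi>)) U \<longleftrightarrow>
     U \<subseteq> \<pi> ` points M \<and> openin (topo M) {x \<in> points M. \<pi> x \<in> U}"
proof -
  have "istopology (\<lambda>U. U \<subseteq> \<pi> ` points M \<and> openin (topo M) {x \<in> points M. \<pi> x \<in> U})"
    unfolding istopology_def
  proof (rule conjI; intro allI impI)
    fix S T
    assume "S \<subseteq> \<pi> ` points M \<and> openin (topo M) {x \<in> points M. \<pi> x \<in> S}"
      and "T \<subseteq> \<pi> ` points M \<and> openin (topo M) {x \<in> points M. \<pi> x \<in> T}"
    moreover have "{x \<in> points M. \<pi> x \<in> S \<inter> T} =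
        {x \<in> points M. \<pi> x \<in> S} \<inter> {x \<in> points M. \<pi> x \<in> T}" by blast
    ultimately show "S \<inter> T \<subseteq> \<pi> ` points M \<and> openin (topo M) {x \<in> points M. \<pi> x \<in> S \<inter> T}"
      by (simp add: openin_Int le_infI1)
  next
    fix K
    assume K: "\<forall>U\<in>K. U \<subseteq> \<pi> ` points M \<and> openin (topo M) {x \<in> points M. \<pi> x \<in> U}"
    have "{x \<in> points M. \<pi> x \<in> \<Union>K} = (\<Union>U\<in>K. {x \<in> points M. \<pi> x \<in> U})" by blast
    then show "\<Union>K \<subseteq> \<pi> ` points M \<and> openin (topo M) {x \<in> points M. \<pi> x \<in> \<Union>K}"
      using K by auto
  qed
  from topology_inverse'[OF this] show ?thesis
    unfolding quotient_space_def fspace.simps by (rule fun_cong)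
qed

lemma points_quotient_space: "points (quotient_space M \<pi>) = \<pi> ` points M"
proof
  show "points (quotient_space M \<pi>) \<subseteq> \<pi> ` points M"
    by (rule openin_quotient_space[THEN iffD1, OF openin_topspace, THEN conjunct1])
  have "{x \<in> points M. \<pi> x \<in> \<pi> ` points M} = points M" by blast
  then have "openin (topo (quotient_space M \<pi>)) (\<pi> ` points M)"
    by (simp add: openin_quotient_space)
  then show "\<pi> ` points M \<subseteq> points (quotient_space M \<pi>)" by (rule openin_subset)
qed

lemma quotient_map_quotient_space: "quotient_map (topo M) (topo (quotient_space M \<pi>)) \<pi>"
  unfolding quotient_map_def by (auto simp: points_quotient_space openin_quotient_space)

definition morphism :: "'a fspace \<Rightarrow> 'b fspace \<Rightarrow> ('a \<Rightarrow> 'b) \<Rightarrow> bool"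
  where "morphism M N f \<longleftrightarrow>
    continuous_map (topo M) (topo N) f \<and>
    (\<forall>V h. openin (topo N) V \<and> h \<in> reg N V \<longrightarrow> h \<circ> f \<in> reg M {x \<in> points M. f x \<in> V})"

definition isomorphism :: "'a fspace \<Rightarrow> 'b fspace \<Rightarrow> ('a \<Rightarrow> 'b) \<Rightarrow> bool"
  where "isomorphism M N f \<longleftrightarrow>
    morphism M N f \<and>
    (\<exists>g. morphism N M g \<and> (\<forall>x\<in>points M. g (f x) = x) \<and> (\<forall>y\<in>points N. f (g y) = y))"

definition open_embedding :: "'a fspace \<Rightarrow> 'b fspace \<Rightarrow> ('a \<Rightarrow> 'b) \<Rightarrow> bool"
  where "open_embedding M N f \<longleftrightarrow>
    openin (topo N) (f ` points M) \<and> isomorphism M (open_subspace N (f ` points M)) f"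


section \<open>Tangent vectors and 2-forms\<close>

definition germs :: "'a fspace \<Rightarrow> 'a \<Rightarrow> ('a \<Rightarrow> complex) set"
  where "germs M x = {f. \<exists>U. openin (topo M) U \<and> x \<in> U \<and> f \<in> reg M U}"

text \<open>
  The Zariski tangent space at \<open>x\<close>: derivations of the local ring at \<open>x\<close>. A derivation is
  represented by its action on functions regular near \<open>x\<close>, depending only on the
  germ at \<open>x\<close>, and has the conventional value \<open>undefined\<close> on all other functions.
\<close>

definition tangent :: "'a fspace \<Rightarrow> 'a \<Rightarrow> (('a \<Rightarrow> complex) \<Rightarrow> complex) set"
  where "tangent M x = {D \<in> extensional (germs M x).
    (\<forall>f\<in>germs M x. \<forall>g\<in>germs M x. \<forall>U.
        openin (topo M) U \<and> x \<in> U \<and> (\<forall>y\<in>U. f y = g y) \<longrightarrow> D f = D g) \<and>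
    (\<forall>f\<in>germs M x. \<forall>g\<in>germs M x. D (\<lambda>y. f y + g y) = D f + D g) \<and>
    (\<forall>c. \<forall>f\<in>germs M x. D (\<lambda>y. c * f y) = c * D f) \<and>
    (\<forall>f\<in>germs M x. \<forall>g\<in>germs M x. D (\<lambda>y. f y * g y) = f x * D g + g x * D f)}"

definition pushforward ::
  "'b fspace \<Rightarrow> ('a \<Rightarrow> 'b) \<Rightarrow> 'a \<Rightarrow> (('a \<Rightarrow> complex) \<Rightarrow> complex) \<Rightarrow> ('b \<Rightarrow> complex) \<Rightarrow> complex"
  where "pushforward N f x D = restrict (\<lambda>h. D (h \<circ> f)) (germs N (f x))"

type_synonym 'a two_form =
  "'a \<Rightarrow> (('a \<Rightarrow> complex) \<Rightarrow> complex) \<Rightarrow> (('a \<Rightarrow> complex) \<Rightarrow> complex) \<Rightarrow> complex"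

definition pullback_form :: "'b fspace \<Rightarrow> ('a \<Rightarrow> 'b) \<Rightarrow> 'b two_form \<Rightarrow> 'a two_form"
  where "pullback_form N f \<omega> x D E = \<omega> (f x) (pushforward N f x D) (pushforward N f x E)"

text \<open>
  The form on the quotient that pulls back to \<open>\<omega>\<close>: its value on two tangent vectors is the
  common value of \<open>\<omega>\<close> on all lifts of them.
\<close>

definition induced_form :: "'a fspace \<Rightarrow> ('a \<Rightarrow> 'b) \<Rightarrow> 'a two_form \<Rightarrow> 'b two_form"
  where "induced_form M \<pi> \<omega> x D E =
    (THE c. \<exists>m\<in>points M. \<exists>D'\<in>tangent M m. \<exists>E'\<in>tangent M m.
       \<pi> m = x \<and>
       pushforward (quotient_space M \<pi>) \<pi> m D' = D \<and>
       pushforward (quotient_space M \<pi>) \<pi> m E' = E \<and>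
       c = \<omega> m D' E')"

definition open_symplectic_embedding ::
  "'a fspace \<Rightarrow> 'a two_form \<Rightarrow> 'b fspace \<Rightarrow> 'b two_form \<Rightarrow> ('a \<Rightarrow> 'b) \<Rightarrow> bool"
  where "open_symplectic_embedding M \<omega>M N \<omega>N f \<longleftrightarrow>
    open_embedding M N f \<and>
    (\<forall>x\<in>points M. \<forall>D\<in>tangent M x. \<forall>E\<in>tangent M x. pullback_form N f \<omega>N x D E = \<omega>M x D E)"


section \<open>Systems of projectors\<close>

type_synonym 'n cmat = "complex^'n^'n"

definition projector :: "'n::finite cmat \<Rightarrow> bool"
  where "projector p \<longleftrightarrow> p ** p = p"

definition orthogonal_projectors :: "'n::finite cmat \<Rightarrow> 'n cmat \<Rightarrow> bool"
  where "orthogonal_projectors p q \<longleftrightarrow> p ** q = 0 \<and> q ** p = 0"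

definition rank1_projectors :: "'n::finite cmat set"
  where "rank1_projectors = {p. projector p \<and> rank p = 1}"

text \<open>
  A system indexed by all of \<open>'n\<close> is automatically complete: its ranges span \<open>\<complex>\<^sup>n\<close>.
\<close>

definition X_set :: "('n::finite cmat^'n) set"
  where "X_set = {p. (\<forall>i. p $ i \<in> rank1_projectors) \<and>
                     (\<forall>i j. i \<noteq> j \<longrightarrow> orthogonal_projectors (p $ i) (p $ j))}"

definition Y_set :: "('n::finite cmat^'n) set"
  where "Y_set = {r. \<forall>i. r $ i \<in> rank1_projectors}"

definition Y_coords :: "('n::finite cmat^'n \<Rightarrow> complex) set"
  where "Y_coords = {\<lambda>r. r $ i $ j $ k | i j k. True}"

definition Y_variety :: "('n::finite cmat^'n) fspace"
  where "Y_variety = subvariety Y_coords Y_set"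

definition coord_proj :: "'n::finite \<Rightarrow> 'n cmat"
  where "coord_proj i = (\<chi> j k. if j = i \<and> k = i then 1 else 0)"

definition diag_part :: "'n::finite cmat \<Rightarrow> 'n cmat"
  where "diag_part B = (\<chi> j k. if j = k then B $ j $ k else 0)"

definition GL :: "'n::finite cmat set"
  where "GL = {g. invertible g}"

definition torus :: "'n::finite cmat set"
  where "torus = {t \<in> GL. diag_part t = t}"

text \<open>Points of the cotangent bundle of \<open>GL\<close> are the pairs \<open>(g, A)\<close> with \<open>g \<in> GL\<close>.\<close>

definition mu_T :: "'n::finite cmat \<times> 'n cmat \<Rightarrow> 'n cmat"
  where "mu_T = (\<lambda>(g, A). diag_part (A ** g))"

definition mu_T_zero :: "('n::finite cmat \<times> 'n cmat) set"
  where "mu_T_zero = {x \<in> GL \<times> UNIV. mu_T x = 0}"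

definition pair_coords :: "('n::finite cmat \<times> 'n cmat \<Rightarrow> complex) set"
  where "pair_coords = {\<lambda>x. fst x $ j $ k | j k. True} \<union> {\<lambda>x. snd x $ j $ k | j k. True}"

definition mu_T_zero_variety :: "('n::finite cmat \<times> 'n cmat) fspace"
  where "mu_T_zero_variety = subvariety pair_coords mu_T_zero"

definition torus_act :: "'n::finite cmat \<Rightarrow> 'n cmat \<times> 'n cmat \<Rightarrow> 'n cmat \<times> 'n cmat"
  where "torus_act t = (\<lambda>(g, A). (g ** matrix_inv t, t ** A))"

definition torus_orbit :: "'n::finite cmat \<times> 'n cmat \<Rightarrow> ('n cmat \<times> 'n cmat) set"
  where "torus_orbit x = {torus_act t x | t. t \<in> torus}"

text \<open>
  The cotangent bundle of \<open>X_set = GL/torus\<close>, presented as the symplectic reduction of the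
  cotangent bundle of \<open>GL\<close>; its points are the torus orbits in \<open>mu_T_zero\<close>. The canonical
  symplectic form is the one induced by \<open>Tr dA dg\<close>.
\<close>

definition cotangent_X :: "('n::finite cmat \<times> 'n cmat) set fspace"
  where "cotangent_X = quotient_space mu_T_zero_variety torus_orbit"

text \<open>
  \<open>matrix_d F D\<close> is the matrix-valued 1-form \<open>dF\<close> evaluated at the tangent vector \<open>D\<close>. The wedge
  product is normalised by \<open>(\<alpha> \<and> \<beta>)(D, E) = \<alpha>(D) \<beta>(E) - \<alpha>(E) \<beta>(D)\<close> throughout.
\<close>

definition matrix_d :: "('a \<Rightarrow> 'n::finite cmat) \<Rightarrow> (('a \<Rightarrow> complex) \<Rightarrow> complex) \<Rightarrow> 'n cmat"
  where "matrix_d F D = (\<chi> j k. D (\<lambda>x. F x $ j $ k))"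

definition matrix_wedge ::
  "('a \<Rightarrow> 'n::finite cmat) \<Rightarrow> ('a \<Rightarrow> 'n cmat) \<Rightarrow>
   (('a \<Rightarrow> complex) \<Rightarrow> complex) \<Rightarrow> (('a \<Rightarrow> complex) \<Rightarrow> complex) \<Rightarrow> 'n cmat"
  where "matrix_wedge F H D E = matrix_d F D ** matrix_d H E - matrix_d F E ** matrix_d H D"

definition omega_GL :: "('n::finite cmat \<times> 'n cmat) two_form"
  where "omega_GL x D E = trace (matrix_wedge snd fst D E)"

definition omega_X :: "('n::finite cmat \<times> 'n cmat) set two_form"
  where "omega_X = induced_form mu_T_zero_variety torus_orbit omega_GL"

definition omega_Y :: "('n::finite cmat^'n) two_form"
  where "omega_Y r D E = trace (\<Sum>i\<in>UNIV. r $ i ** matrix_wedge (\<lambda>s. s $ i) (\<lambda>s. s $ i) D E)"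

definition projector_system :: "'n::finite cmat \<Rightarrow> 'n cmat^'n"
  where "projector_system g = (\<chi> i. g ** coord_proj i ** matrix_inv g)"

definition phi_rep :: "'n::finite cmat \<times> 'n cmat \<Rightarrow> 'n cmat^'n"
  where "phi_rep = (\<lambda>(g, A). \<chi> i. projector_system g $ i ** (mat 1 + g ** A))"

definition phi :: "('n::finite cmat \<times> 'n cmat) set \<Rightarrow> 'n cmat^'n"
  where "phi C = the_elem (phi_rep ` C)"


section \<open>Consistency of the definitions\<close>

lemma matrix_inv_props:
  assumes "invertible (A :: 'n::finite cmat)"
  shows "A ** matrix_inv A = mat 1" "matrix_inv A ** A = mat 1"
  using assms someI_ex[of "\<lambda>A'. A ** A' = mat 1 \<and> A' ** A = mat 1"]
  unfolding invertible_def matrix_inv_def by auto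

lemma torus_commute:
  assumes "diag_part t = t"
  shows "t ** coord_proj i = coord_proj i ** t"
proof -
  have *: "t $ j $ k = 0" if "j \<noteq> k" for j k
  proof -
    have "t $ j $ k = diag_part t $ j $ k" by (simp add: assms)
    then show ?thesis using that by (simp add: diag_part_def)
  qed
  have "(t ** coord_proj i) $ j $ k = (coord_proj i ** t) $ j $ k" for j k
  proof -
    have "(t ** coord_proj i) $ j $ k = (\<Sum>l\<in>UNIV. if l = i then (if k = i then t $ j $ l else 0) else 0)"
      unfolding matrix_matrix_mult_def coord_proj_def vec_lambda_beta by (intro sum.cong) auto
    also have "\<dots> = (if k = i then t $ j $ i else 0)" by (simp add: sum.delta)
    also have "\<dots> = (if j = i then t $ i $ k else 0)" using *[of j i] *[of i k] by auto
    also have "\<dots> = (\<Sum>l\<in>UNIV. if l = i then (if j = i then t $ l $ k else 0) else 0)"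
      by (simp add: sum.delta)
    also have "\<dots> = (coord_proj i ** t) $ j $ k"
      unfolding matrix_matrix_mult_def coord_proj_def vec_lambda_beta by (intro sum.cong) auto
    finally show ?thesis .
  qed
  then show ?thesis by (simp add: vec_eq_iff)
qed

lemma matrix_inv_eqI:
  fixes A B :: "'n::finite cmat"
  assumes "A ** B = mat 1" "B ** A = mat 1"
  shows "matrix_inv A = B"
  by (metis assms invertible_def matrix_inv_props(1) matrix_mul_assoc matrix_mul_lid matrix_mul_rid)

lemma matrix_inv_torus:
  fixes g t :: "'n::finite cmat"
  assumes "invertible g" "invertible t"
  shows "matrix_inv (g ** matrix_inv t) = t ** matrix_inv g"
proof (rule matrix_inv_eqI)
  have "(g ** matrix_inv t) ** (t ** matrix_inv g) = g ** (matrix_inv t ** t) ** matrix_inv g"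
    by (simp only: matrix_mul_assoc)
  then show "(g ** matrix_inv t) ** (t ** matrix_inv g) = mat 1"
    by (simp add: matrix_inv_props assms)
  have "(t ** matrix_inv g) ** (g ** matrix_inv t) = t ** (matrix_inv g ** g) ** matrix_inv t"
    by (simp only: matrix_mul_assoc)
  then show "(t ** matrix_inv g) ** (g ** matrix_inv t) = mat 1"
    by (simp add: matrix_inv_props assms)
qed

lemma projector_system_torus:
  assumes "invertible g" "t \<in> torus"
  shows "projector_system (g ** matrix_inv t) = projector_system g"
proof -
  have t: "invertible t" "diag_part t = t" using assms(2) by (auto simp: torus_def GL_def)
  have "g ** matrix_inv t ** coord_proj i ** matrix_inv (g ** matrix_inv t)
      = g ** coord_proj i ** matrix_inv g" for i
  proof -
    have "g ** matrix_inv t ** coord_proj i ** (t ** matrix_inv g)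
        = g ** matrix_inv t ** (coord_proj i ** t) ** matrix_inv g"
      by (simp only: matrix_mul_assoc)
    also have "\<dots> = g ** matrix_inv t ** (t ** coord_proj i) ** matrix_inv g"
      by (simp only: torus_commute[OF t(2)])
    also have "\<dots> = g ** (matrix_inv t ** t) ** coord_proj i ** matrix_inv g"
      by (simp only: matrix_mul_assoc)
    finally show ?thesis by (simp add: matrix_inv_props t matrix_inv_torus assms(1))
  qed
  then show ?thesis by (simp add: projector_system_def)
qed

lemma phi_rep_torus_act:
  assumes "invertible (fst x)" "t \<in> torus"
  shows "phi_rep (torus_act t x) = phi_rep x"
proof -
  have t: "invertible t" using assms(2) by (auto simp: torus_def GL_def)
  obtain g A where x: "x = (g, A)" by (cases x)
  have "(g ** matrix_inv t) ** (t ** A) = g ** (matrix_inv t ** t) ** A"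
    by (simp only: matrix_mul_assoc)
  also have "\<dots> = g ** A" by (simp add: matrix_inv_props t)
  finally show ?thesis
    using assms by (simp add: x phi_rep_def torus_act_def projector_system_torus)
qed

text \<open>\<open>phi\<close> is well defined on torus orbits.\<close>

lemma phi_torus_orbit:
  assumes "x \<in> mu_T_zero"
  shows "phi (torus_orbit x) = phi_rep x"
proof -
  have inv: "invertible (fst x)" using assms by (auto simp: mu_T_zero_def GL_def)
  have "invertible (mat 1 :: 'a cmat)" unfolding invertible_def by (rule exI[of _ "mat 1"]) simp
  moreover have "diag_part (mat 1) = (mat 1 :: 'a cmat)"
    by (simp add: diag_part_def mat_def vec_eq_iff)
  ultimately have "(mat 1 :: 'a cmat) \<in> torus" by (simp add: torus_def GL_def)
  then have "torus_orbit x \<noteq> {}" unfolding torus_orbit_def by blast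
  moreover have "phi_rep y = phi_rep x" if "y \<in> torus_orbit x" for y
    using that phi_rep_torus_act[OF inv] by (auto simp: torus_orbit_def)
  then have "phi_rep ` torus_orbit x = (\<lambda>_. phi_rep x) ` torus_orbit x"
    by (intro image_cong refl)
  ultimately have "phi_rep ` torus_orbit x = {phi_rep x}" by (simp add: image_constant_conv)
  then show ?thesis by (simp add: phi_def)
qed

text \<open>
  The map \<open>projector_system\<close> identifies the quotient of \<open>GL\<close> by the torus with \<open>X_set\<close>.
\<close>

lemma rank_outer:
  fixes u v :: "complex^'n::finite"
  assumes "u \<noteq> 0" "v \<noteq> 0"
  shows "rank (\<chi> j k. u $ j * v $ k) = 1"
proof -
  obtain j where j: "u $ j \<noteq> 0" using assms(1) by (auto simp: vec_eq_iff)
  have rows: "rows (\<chi> j k. u $ j * v $ k) = range (\<lambda>j. u $ j *s v)"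
    by (auto simp: rows_def row_def vec_eq_iff)
  have nz: "u $ j *s v \<noteq> 0" using j assms(2) by (auto simp: vec_eq_iff)
  have "vec.dim (range (\<lambda>j. u $ j *s v)) = 1"
  proof (rule vec.dim_unique)
    show "{u $ j *s v} \<subseteq> range (\<lambda>j. u $ j *s v)" by blast
    show "range (\<lambda>j. u $ j *s v) \<subseteq> vec.span {u $ j *s v}"
    proof clarify
      fix i
      have "u $ i *s v = (u $ i / u $ j) *s (u $ j *s v)" using j by (simp add: vec_eq_iff)
      then show "u $ i *s v \<in> vec.span {u $ j *s v}"
        by (metis vec.span_base vec.span_scale singletonI)
    qed
    show "vec.independent {u $ j *s v}" using nz by simp
  qed simp
  then show ?thesis by (simp add: row_rank_def_gen rows)
qed

lemma rank1_nonzero: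
  assumes "rank (p :: 'n::finite cmat) = 1"
  shows "p \<noteq> 0"
proof
  assume "p = 0"
  then have "rows p = {0}" by (auto simp: rows_def row_def vec_eq_iff)
  then have "vec.dim (rows p) = 0" by (simp add: vec.dim_eq_0)
  with assms show False by (simp add: row_rank_def_gen)
qed

lemma coord_proj_mult:
  "coord_proj i ** coord_proj j = (if i = j then coord_proj i else (0 :: 'n::finite cmat))"
proof -
  have "(coord_proj i ** coord_proj j) $ a $ b
      = (if i = j then coord_proj i else (0 :: 'n cmat)) $ a $ b" for a b
  proof -
    have "(coord_proj i ** coord_proj j) $ a $ b
        = (\<Sum>l\<in>UNIV. if l = i then (if a = i \<and> i = j \<and> b = j then 1 else 0) else 0)"
      unfolding matrix_matrix_mult_def coord_proj_def vec_lambda_beta by (intro sum.cong) auto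
    then show ?thesis by (auto simp: sum.delta coord_proj_def)
  qed
  then show ?thesis by (simp add: vec_eq_iff)
qed

lemma matrix_mult_coord_proj: "(g ** coord_proj i) $ a $ b = (if b = i then g $ a $ i else 0)"
proof -
  have "(g ** coord_proj i) $ a $ b = (\<Sum>l\<in>UNIV. if l = i then (if b = i then g $ a $ l else 0) else 0)"
    unfolding matrix_matrix_mult_def coord_proj_def vec_lambda_beta by (intro sum.cong) auto
  then show ?thesis by (simp add: sum.delta)
qed

lemma projector_system_mult:
  assumes "invertible g"
  shows "projector_system g $ i ** projector_system g $ j
    = (if i = j then projector_system g $ i else 0)"
proof -
  have "projector_system g $ i ** projector_system g $ j
      = g ** coord_proj i ** (matrix_inv g ** g) ** coord_proj j ** matrix_inv g"
    unfolding projector_system_def vec_lambda_beta by (simp only: matrix_mul_assoc)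
  also have "\<dots> = g ** (coord_proj i ** coord_proj j) ** matrix_inv g"
    by (simp add: matrix_inv_props assms matrix_mul_assoc)
  also have "\<dots> = (if i = j then projector_system g $ i else 0)"
    by (simp add: coord_proj_mult projector_system_def)
  finally show ?thesis .
qed

lemma projector_system_rank:
  assumes "invertible g"
  shows "rank (projector_system g $ i) = 1"
proof -
  define u where "u = (\<chi> j. g $ j $ i)"
  define v where "v = matrix_inv g $ i"
  have inv: "(\<Sum>j\<in>UNIV. v $ j * u $ j) = 1"
  proof -
    have "(matrix_inv g ** g) $ i $ i = 1" by (simp add: matrix_inv_props assms mat_def)
    then show ?thesis by (simp add: matrix_matrix_mult_def u_def v_def)
  qed
  have uv: "u \<noteq> 0" "v \<noteq> 0" using inv by auto
  have "projector_system g $ i = (\<chi> j k. u $ j * v $ k)"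
  proof -
    have "(g ** coord_proj i ** matrix_inv g) $ j $ k = u $ j * v $ k" for j k
    proof -
      have "(g ** coord_proj i ** matrix_inv g) $ j $ k
          = (\<Sum>l\<in>UNIV. (g ** coord_proj i) $ j $ l * matrix_inv g $ l $ k)"
        by (simp add: matrix_matrix_mult_def[of "g ** coord_proj i"])
      also have "\<dots> = (\<Sum>l\<in>UNIV. if l = i then g $ j $ i * matrix_inv g $ l $ k else 0)"
        unfolding matrix_mult_coord_proj by (intro sum.cong) auto
      also have "\<dots> = u $ j * v $ k" by (simp add: sum.delta u_def v_def)
      finally show ?thesis .
    qed
    then show ?thesis by (simp add: projector_system_def vec_eq_iff)
  qed
  then show ?thesis using rank_outer[OF uv] by simp
qed

lemma projector_system_image: "projector_system ` GL = (X_set :: ('n::finite cmat^'n) set)"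
proof
  show "projector_system ` GL \<subseteq> (X_set :: ('n cmat^'n) set)"
    by (auto simp: X_set_def GL_def rank1_projectors_def projector_def orthogonal_projectors_def
        projector_system_mult projector_system_rank simp del: One_nat_def)
  show "(X_set :: ('n cmat^'n) set) \<subseteq> projector_system ` GL"
  proof
    fix p :: "'n cmat^'n" assume p: "p \<in> X_set"
    have "\<exists>x. p $ i *v x \<noteq> 0" for i
      using p rank1_nonzero[of "p $ i"]
      by (auto simp: X_set_def rank1_projectors_def matrix_eq)
    then obtain w where w: "\<And>i. p $ i *v w i \<noteq> 0" by metis
    define u where "u i = p $ i *v w i" for i
    have pu: "p $ i *v u j = (if i = j then u j else 0)" for i j
    proof -
      have "p $ i ** p $ j = (if i = j then p $ j else 0)"
        using p by (auto simp: X_set_def rank1_projectors_def projector_def orthogonal_projectors_def)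
      then show ?thesis by (simp add: u_def matrix_vector_mul_assoc)
    qed
    define g :: "'n cmat" where "g = (\<chi> a b. u b $ a)"
    have pg: "p $ i ** g = g ** coord_proj i" for i
    proof -
      have "(p $ i ** g) $ a $ b = (g ** coord_proj i) $ a $ b" for a b
      proof -
        have "(p $ i ** g) $ a $ b = (p $ i *v u b) $ a"
          by (simp add: matrix_matrix_mult_def matrix_vector_mult_def g_def)
        then show ?thesis unfolding matrix_mult_coord_proj by (auto simp: pu g_def)
      qed
      then show ?thesis by (simp add: vec_eq_iff)
    qed
    have "invertible g"
    proof -
      have "c = 0" if c: "g *v c = 0" for c
      proof -
        have "c $ i = 0" for i
        proof -
          have "(g ** coord_proj i) *v c = p $ i *v (g *v c)"
            by (simp add: matrix_vector_mul_assoc pg)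
          then have z: "(g ** coord_proj i) *v c = 0" by (simp add: c)
          have "((g ** coord_proj i) *v c) $ a = u i $ a * c $ i" for a
          proof -
            have "((g ** coord_proj i) *v c) $ a
                = (\<Sum>b\<in>UNIV. (g ** coord_proj i) $ a $ b * c $ b)"
              by (simp add: matrix_vector_mult_def)
            also have "\<dots> = (\<Sum>b\<in>UNIV. if b = i then g $ a $ i * c $ b else 0)"
              unfolding matrix_mult_coord_proj by (intro sum.cong) auto
            finally show ?thesis by (simp add: sum.delta g_def)
          qed
          then have "u i $ a * c $ i = 0" for a using z by (metis zero_index)
          moreover obtain a where "u i $ a \<noteq> 0" using w[of i] by (auto simp: u_def vec_eq_iff)
          ultimately show ?thesis by (metis mult_eq_0_iff)
        qed
        then show ?thesis by (simp add: vec_eq_iff)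
      qed
      then show ?thesis
        by (simp add: invertible_left_inverse matrix_left_invertible_ker)
    qed
    moreover have "projector_system g = p"
    proof -
      have "g ** coord_proj i ** matrix_inv g = p $ i ** (g ** matrix_inv g)" for i
        by (simp only: pg[symmetric] matrix_mul_assoc)
      then show ?thesis
        by (simp add: projector_system_def vec_eq_iff matrix_inv_props \<open>invertible g\<close>)
    qed
    ultimately show "p \<in> projector_system ` GL" by (auto simp: GL_def)
  qed
qed

lemma projector_system_eq_iff:
  assumes "g \<in> GL" "h \<in> GL"
  shows "projector_system g = projector_system h \<longleftrightarrow> (\<exists>t\<in>torus. h = g ** matrix_inv t)"
proof
  assume "\<exists>t\<in>torus. h = g ** matrix_inv t"
  then show "projector_system g = projector_system h"
    using assms by (auto simp: GL_def projector_system_torus)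
next
  assume eq: "projector_system g = projector_system h"
  have g: "invertible g" and h: "invertible h" using assms by (auto simp: GL_def)
  define t where "t = matrix_inv h ** g"
  have comm: "t ** coord_proj i = coord_proj i ** t" for i
  proof -
    have e: "g ** coord_proj i ** matrix_inv g = h ** coord_proj i ** matrix_inv h"
      using eq by (simp add: projector_system_def vec_eq_iff)
    have "t ** coord_proj i = matrix_inv h ** (g ** coord_proj i ** matrix_inv g) ** g"
      by (simp add: t_def matrix_mul_assoc[symmetric] matrix_inv_props g)
    also have "\<dots> = (matrix_inv h ** h) ** coord_proj i ** (matrix_inv h ** g)"
      unfolding e by (simp only: matrix_mul_assoc)
    finally show ?thesis by (simp add: t_def matrix_inv_props h)
  qed
  have "t $ a $ b = 0" if "a \<noteq> b" for a b
  proof -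
    have "(coord_proj b ** t) $ a $ b = 0"
      unfolding matrix_matrix_mult_def coord_proj_def vec_lambda_beta using that by simp
    moreover have "(t ** coord_proj b) $ a $ b = t $ a $ b" by (simp add: matrix_mult_coord_proj)
    ultimately show ?thesis by (simp add: comm)
  qed
  then have "diag_part t = t" by (auto simp: diag_part_def vec_eq_iff)
  moreover have tinv: "t ** (matrix_inv g ** h) = mat 1" "(matrix_inv g ** h) ** t = mat 1"
  proof -
    have "t ** (matrix_inv g ** h) = matrix_inv h ** (g ** matrix_inv g) ** h"
      by (simp only: t_def matrix_mul_assoc)
    then show "t ** (matrix_inv g ** h) = mat 1" by (simp add: matrix_inv_props g h)
    have "(matrix_inv g ** h) ** t = matrix_inv g ** (h ** matrix_inv h) ** g"
      by (simp only: t_def matrix_mul_assoc)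
    then show "(matrix_inv g ** h) ** t = mat 1" by (simp add: matrix_inv_props g h)
  qed
  ultimately have "t \<in> torus" by (auto simp: torus_def GL_def invertible_def)
  moreover have "h = g ** matrix_inv t"
    by (simp add: matrix_inv_eqI[OF tinv] matrix_mul_assoc matrix_inv_props g)
  ultimately show "\<exists>t\<in>torus. h = g ** matrix_inv t" by blast
qed

end

theory Submission
  imports Defs
begin

text \<open>
  Write \<open>u\<^sub>i\<close> for the columns of \<open>g\<close> and \<open>b\<^sub>i\<close> for the rows of \<open>g\<^sup>-\<^sup>1 + A\<close>. Then \<open>r\<^sub>i = u\<^sub>i b\<^sub>i\<close>, and the
  moment map equation says \<open>b\<^sub>i u\<^sub>i = 1\<close>. Such a factorisation is unique up to the torus, so \<open>phi\<close> is
  injective, and its image consists of the systems whose ranges are linearly independent. This is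
  covered by the open sets on which some choice of one column from each \<open>r\<^sub>i\<close> is invertible; there
  these columns serve as \<open>g\<close>, which gives a regular local section, hence a regular inverse.
  For the forms, \<open>b\<^sub>i u\<^sub>i = 1\<close> reduces \<open>Tr \<Sum> r\<^sub>i dr\<^sub>i dr\<^sub>i\<close> to \<open>\<Sum> db\<^sub>i du\<^sub>i = Tr d(g\<^sup>-\<^sup>1 + A) dg\<close>, and
  \<open>Tr d(g\<^sup>-\<^sup>1) dg = - Tr g\<^sup>-\<^sup>1 dg g\<^sup>-\<^sup>1 dg\<close> vanishes by cyclicity of the trace.
\<close>

section \<open>Regular functions and regular maps\<close>

abbreviation sub_open :: "('a \<Rightarrow> complex) set \<Rightarrow> 'a set \<Rightarrow> 'a set \<Rightarrow> bool"
  where "sub_open X S \<equiv> openin (subtopology (zariski X) S)"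

abbreviation sub_reg :: "('a \<Rightarrow> complex) set \<Rightarrow> 'a set \<Rightarrow> 'a set \<Rightarrow> ('a \<Rightarrow> complex) set"
  where "sub_reg X S \<equiv> reg (subvariety X S)"

lemma topo_subvariety [simp]: "topo (subvariety X S) = subtopology (zariski X) S"
  by (simp add: subvariety_def)

lemma sub_open_self: "sub_open X S S"
  by (simp add: openin_subtopology_refl)

lemma sub_reg_iff:
  "f \<in> sub_reg X S U \<longleftrightarrow> (\<forall>x\<in>U. \<exists>V p q. sub_open X S V \<and> x \<in> V \<and> V \<subseteq> U \<and>
     p \<in> polynomials X \<and> q \<in> polynomials X \<and> (\<forall>y\<in>V. q y \<noteq> 0 \<and> f y = p y / q y))"
  by (simp add: subvariety_def)

lemma sub_regE:
  assumes "f \<in> sub_reg X S U" "x \<in> U"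
  obtains V p q where "sub_open X S V" "x \<in> V" "V \<subseteq> U" "p \<in> polynomials X"
    "q \<in> polynomials X" "\<forall>y\<in>V. q y \<noteq> 0 \<and> f y = p y / q y"
  using bspec[OF assms(1)[unfolded sub_reg_iff] assms(2)] that by (elim exE conjE)

lemma sub_regI:
  assumes "\<And>x. x \<in> U \<Longrightarrow> \<exists>V p q. sub_open X S V \<and> x \<in> V \<and> V \<subseteq> U \<and>
     p \<in> polynomials X \<and> q \<in> polynomials X \<and> (\<forall>y\<in>V. q y \<noteq> 0 \<and> f y = p y / q y)"
  shows "f \<in> sub_reg X S U"
  unfolding sub_reg_iff using assms by (rule ballI)

lemma fraction_nearI:
  assumes "sub_open X S V" "x \<in> V" "V \<subseteq> U" "p \<in> polynomials X" "q \<in> polynomials X"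
    "\<And>y. y \<in> V \<Longrightarrow> q y \<noteq> 0" "\<And>y. y \<in> V \<Longrightarrow> f y = p y / q y"
  shows "\<exists>V p q. sub_open X S V \<and> x \<in> V \<and> V \<subseteq> U \<and>
     p \<in> polynomials X \<and> q \<in> polynomials X \<and> (\<forall>y\<in>V. q y \<noteq> 0 \<and> f y = p y / q y)"
  by (rule exI[of _ V], rule exI[of _ p], rule exI[of _ q]) (use assms in auto)

lemma openin_principal: "p \<in> polynomials X \<Longrightarrow> openin (zariski X) {x. p x \<noteq> 0}"
  unfolding openin_zariski zariski_open_iff by (intro ballI bexI[of _ p]) auto

text \<open>The gluing half of the sheaf property; it allows the inverse of \<open>phi\<close> to be
  checked one chart at a time.\<close>

lemma sub_reg_local:
  assumes "\<And>x. x \<in> U \<Longrightarrow> \<exists>V. x \<in> V \<and> V \<subseteq> U \<and> f \<in> sub_reg X S V"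
  shows "f \<in> sub_reg X S U"
proof (rule sub_regI)
  fix x assume "x \<in> U"
  then obtain V where V: "x \<in> V" "V \<subseteq> U" "f \<in> sub_reg X S V" using assms by blast
  from V(3,1) obtain V' p q where "sub_open X S V'" "x \<in> V'" "V' \<subseteq> V" "p \<in> polynomials X"
    "q \<in> polynomials X" "\<forall>y\<in>V'. q y \<noteq> 0 \<and> f y = p y / q y"
    by (rule sub_regE)
  then show "\<exists>V p q. sub_open X S V \<and> x \<in> V \<and> V \<subseteq> U \<and>
     p \<in> polynomials X \<and> q \<in> polynomials X \<and> (\<forall>y\<in>V. q y \<noteq> 0 \<and> f y = p y / q y)"
    using V(2) by (intro fraction_nearI[where V = V' and p = p and q = q]) auto
qed

lemma sub_reg_cong:
  assumes "f \<in> sub_reg X S U" "\<And>x. x \<in> U \<Longrightarrow> g x = f x"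
  shows "g \<in> sub_reg X S U"
proof (rule sub_regI)
  fix x assume "x \<in> U"
  with assms(1) obtain V p q where "sub_open X S V" "x \<in> V" "V \<subseteq> U" "p \<in> polynomials X"
    "q \<in> polynomials X" "\<forall>y\<in>V. q y \<noteq> 0 \<and> f y = p y / q y"
    by (rule sub_regE)
  then show "\<exists>V p q. sub_open X S V \<and> x \<in> V \<and> V \<subseteq> U \<and>
     p \<in> polynomials X \<and> q \<in> polynomials X \<and> (\<forall>y\<in>V. q y \<noteq> 0 \<and> g y = p y / q y)"
    using assms(2) by (intro fraction_nearI[where V = V and p = p and q = q]) auto
qed

lemma sub_reg_mono:
  assumes "f \<in> sub_reg X S U" "sub_open X S U'" "U' \<subseteq> U"
  shows "f \<in> sub_reg X S U'"
proof (rule sub_regI)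
  fix x assume x: "x \<in> U'"
  then have "x \<in> U" using assms(3) by blast
  with assms(1) obtain V p q where *: "sub_open X S V" "x \<in> V" "V \<subseteq> U" "p \<in> polynomials X"
    "q \<in> polynomials X" "\<forall>y\<in>V. q y \<noteq> 0 \<and> f y = p y / q y"
    by (rule sub_regE)
  show "\<exists>V p q. sub_open X S V \<and> x \<in> V \<and> V \<subseteq> U' \<and>
     p \<in> polynomials X \<and> q \<in> polynomials X \<and> (\<forall>y\<in>V. q y \<noteq> 0 \<and> f y = p y / q y)"
    by (intro fraction_nearI[where V = "V \<inter> U'" and p = p and q = q])
       (use * x assms(2) in \<open>auto intro: openin_Int\<close>)
qed

lemma sub_reg_polynomial:
  assumes "p \<in> polynomials X" "sub_open X S U"
  shows "p \<in> sub_reg X S U"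
proof (rule sub_regI)
  fix x assume "x \<in> U"
  then show "\<exists>V p' q. sub_open X S V \<and> x \<in> V \<and> V \<subseteq> U \<and>
     p' \<in> polynomials X \<and> q \<in> polynomials X \<and> (\<forall>y\<in>V. q y \<noteq> 0 \<and> p y = p' y / q y)"
    by (intro fraction_nearI[where V = U and p = p and q = "\<lambda>_. 1"]) (use assms polynomials.const in auto)
qed

lemmas sub_reg_coord = sub_reg_polynomial[OF polynomials.coord]
lemmas sub_reg_const = sub_reg_polynomial[OF polynomials.const]

lemma sub_reg_add:
  assumes "f \<in> sub_reg X S U" "g \<in> sub_reg X S U"
  shows "(\<lambda>x. f x + g x) \<in> sub_reg X S U"
proof (rule sub_regI)
  fix x assume x: "x \<in> U"
  from assms(1) x obtain V p q where 1: "sub_open X S V" "x \<in> V" "V \<subseteq> U" "p \<in> polynomials X"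
    "q \<in> polynomials X" "\<forall>y\<in>V. q y \<noteq> 0 \<and> f y = p y / q y"
    by (rule sub_regE)
  from assms(2) x obtain V' p' q' where 2: "sub_open X S V'" "x \<in> V'" "V' \<subseteq> U" "p' \<in> polynomials X"
    "q' \<in> polynomials X" "\<forall>y\<in>V'. q' y \<noteq> 0 \<and> g y = p' y / q' y"
    by (rule sub_regE)
  show "\<exists>V p q. sub_open X S V \<and> x \<in> V \<and> V \<subseteq> U \<and>
     p \<in> polynomials X \<and> q \<in> polynomials X \<and> (\<forall>y\<in>V. q y \<noteq> 0 \<and> f y + g y = p y / q y)"
    by (intro fraction_nearI[where V = "V \<inter> V'" and p = "\<lambda>y. p y * q' y + p' y * q y" and q = "\<lambda>y. q y * q' y"])
       (use 1 2 in \<open>auto intro!: openin_Int polynomials.add polynomials.mult simp: field_simps\<close>)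
qed

lemma sub_reg_mult:
  assumes "f \<in> sub_reg X S U" "g \<in> sub_reg X S U"
  shows "(\<lambda>x. f x * g x) \<in> sub_reg X S U"
proof (rule sub_regI)
  fix x assume x: "x \<in> U"
  from assms(1) x obtain V p q where 1: "sub_open X S V" "x \<in> V" "V \<subseteq> U" "p \<in> polynomials X"
    "q \<in> polynomials X" "\<forall>y\<in>V. q y \<noteq> 0 \<and> f y = p y / q y"
    by (rule sub_regE)
  from assms(2) x obtain V' p' q' where 2: "sub_open X S V'" "x \<in> V'" "V' \<subseteq> U" "p' \<in> polynomials X"
    "q' \<in> polynomials X" "\<forall>y\<in>V'. q' y \<noteq> 0 \<and> g y = p' y / q' y"
    by (rule sub_regE)
  show "\<exists>V p q. sub_open X S V \<and> x \<in> V \<and> V \<subseteq> U \<and>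
     p \<in> polynomials X \<and> q \<in> polynomials X \<and> (\<forall>y\<in>V. q y \<noteq> 0 \<and> f y * g y = p y / q y)"
    by (intro fraction_nearI[where V = "V \<inter> V'" and p = "\<lambda>y. p y * p' y" and q = "\<lambda>y. q y * q' y"])
       (use 1 2 in \<open>auto intro!: openin_Int polynomials.add polynomials.mult simp: field_simps\<close>)
qed

text \<open>Near each point \<open>f\<close> is a fraction \<open>p / q\<close> and vanishes exactly
  where \<open>p\<close> does, so the locus is a union of relatively principal open pieces.\<close>

lemma sub_open_nonzero:
  assumes "f \<in> sub_reg X S U"
  shows "sub_open X S {x \<in> U. f x \<noteq> 0}"
proof (subst openin_subopen, intro ballI)
  fix x assume x: "x \<in> {x \<in> U. f x \<noteq> 0}"
  then have "x \<in> U" by simp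
  with assms obtain V p q where 1: "sub_open X S V" "x \<in> V" "V \<subseteq> U" "p \<in> polynomials X"
    "q \<in> polynomials X" "\<forall>y\<in>V. q y \<noteq> 0 \<and> f y = p y / q y"
    by (rule sub_regE)
  have "sub_open X S (V \<inter> ({x. p x \<noteq> 0} \<inter> S))"
    by (intro openin_Int 1 openin_subtopology_Int openin_principal)
  moreover have "V \<subseteq> S" using openin_subset[OF 1(1)] by simp
  ultimately show "\<exists>T. sub_open X S T \<and> x \<in> T \<and> T \<subseteq> {x \<in> U. f x \<noteq> 0}"
    by (intro exI[of _ "V \<inter> ({x. p x \<noteq> 0} \<inter> S)"]) (use 1 x in auto)
qed

lemma sub_reg_inverse:
  assumes "f \<in> sub_reg X S U" "\<And>x. x \<in> U \<Longrightarrow> f x \<noteq> 0"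
  shows "(\<lambda>x. inverse (f x)) \<in> sub_reg X S U"
proof (rule sub_regI)
  fix x assume x: "x \<in> U"
  from assms(1) x obtain V p q where 1: "sub_open X S V" "x \<in> V" "V \<subseteq> U" "p \<in> polynomials X"
    "q \<in> polynomials X" "\<forall>y\<in>V. q y \<noteq> 0 \<and> f y = p y / q y"
    by (rule sub_regE)
  then have "p y \<noteq> 0" if "y \<in> V" for y using that assms(2)[of y] by auto
  with 1 show "\<exists>V p q. sub_open X S V \<and> x \<in> V \<and> V \<subseteq> U \<and>
     p \<in> polynomials X \<and> q \<in> polynomials X \<and> (\<forall>y\<in>V. q y \<noteq> 0 \<and> inverse (f y) = p y / q y)"
    by (intro fraction_nearI[where V = V and p = q and q = p]) auto
qed

lemma sub_reg_minus:
  assumes "f \<in> sub_reg X S U" "sub_open X S U"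
  shows "(\<lambda>x. - f x) \<in> sub_reg X S U"
  using sub_reg_mult[OF sub_reg_const[OF assms(2), of "-1"] assms(1)] by simp

lemma sub_reg_diff:
  assumes "f \<in> sub_reg X S U" "g \<in> sub_reg X S U" "sub_open X S U"
  shows "(\<lambda>x. f x - g x) \<in> sub_reg X S U"
  using sub_reg_add[OF assms(1) sub_reg_minus[OF assms(2,3)]] by simp

lemma sub_reg_sum:
  assumes "\<And>i. i \<in> I \<Longrightarrow> f i \<in> sub_reg X S U" "sub_open X S U"
  shows "(\<lambda>x. \<Sum>i\<in>I. f i x) \<in> sub_reg X S U"
  using assms
  by (induction I rule: infinite_finite_induct) (simp_all add: sub_reg_const sub_reg_add)

lemma sub_reg_prod:
  assumes "\<And>i. i \<in> I \<Longrightarrow> f i \<in> sub_reg X S U" "sub_open X S U"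
  shows "(\<lambda>x. \<Prod>i\<in>I. f i x) \<in> sub_reg X S U"
  using assms
  by (induction I rule: infinite_finite_induct) (simp_all add: sub_reg_const sub_reg_mult)

section \<open>Regularity of determinants and inverse matrices\<close>

lemma sub_reg_det:
  fixes F :: "'a \<Rightarrow> 'n::finite cmat"
  assumes "\<And>i j. (\<lambda>x. F x $ i $ j) \<in> sub_reg X S U" "sub_open X S U"
  shows "(\<lambda>x. det (F x)) \<in> sub_reg X S U"
  unfolding det_def by (intro sub_reg_sum sub_reg_mult sub_reg_prod sub_reg_const assms)

text \<open>Cramer's rule for column \<open>j\<close> of the inverse, which solves
  \<open>A *v x = e_j\<close>. It shows the entries of the inverse to be quotients of polynomials in
  the entries of \<open>A\<close>.\<close>

lemma matrix_inv_entry: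
  fixes A :: "'n::finite cmat"
  assumes "invertible A"
  shows "matrix_inv A $ i $ j =
    det (\<chi> a b. if b = i then (if a = j then 1 else 0) else A $ a $ b) * inverse (det A)"
proof -
  define x where "x = (\<chi> i. matrix_inv A $ i $ j)"
  have "(A *v x) $ a = (A ** matrix_inv A) $ a $ j" for a
    by (simp add: x_def matrix_vector_mult_def matrix_matrix_mult_def)
  then have Ax: "(A *v x) $ a = (if a = j then 1 else 0)" for a
    by (simp add: matrix_inv_props assms mat_def)
  have "det (\<chi> a b. if b = i then (if a = j then 1 else 0) else A $ a $ b) = x $ i * det A"
    using cramer_lemma[where k = i and A = A and x = x] unfolding Ax .
  moreover have "det A \<noteq> 0" using assms by (simp add: invertible_det_nz)
  ultimately show ?thesis by (simp add: x_def)
qed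

lemma sub_reg_matrix_inv:
  fixes F :: "'a \<Rightarrow> 'n::finite cmat"
  assumes F: "\<And>i j. (\<lambda>x. F x $ i $ j) \<in> sub_reg X S U" and U: "sub_open X S U"
    and inv: "\<And>x. x \<in> U \<Longrightarrow> invertible (F x)"
  shows "(\<lambda>x. matrix_inv (F x) $ i $ j) \<in> sub_reg X S U"
proof (rule sub_reg_cong)
  have "(\<lambda>x. det (\<chi> a b. if b = i then (if a = j then 1 else 0) else F x $ a $ b)) \<in> sub_reg X S U"
  proof (rule sub_reg_det)
    fix a b
    \<comment> \<open>The conditions concern indices only, so each entry is either a constant
      function or an entry of \<open>F\<close>.\<close>
    have "(\<lambda>x. if b = i then (if a = j then 1 else 0) else F x $ a $ b) \<in> sub_reg X S U"
      using F U by (cases "b = i"; cases "a = j") (simp_all add: sub_reg_const)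
    then show "(\<lambda>x. (\<chi> a b. if b = i then (if a = j then 1 else 0) else F x $ a $ b) $ a $ b)
        \<in> sub_reg X S U"
      by simp
  qed (rule U)
  moreover have "(\<lambda>x. inverse (det (F x))) \<in> sub_reg X S U"
    using inv by (intro sub_reg_inverse sub_reg_det F U) (simp add: invertible_det_nz)
  ultimately show "(\<lambda>x. det (\<chi> a b. if b = i then (if a = j then 1 else 0) else F x $ a $ b)
      * inverse (det (F x))) \<in> sub_reg X S U"
    by (rule sub_reg_mult)
qed (rule matrix_inv_entry[OF inv])

text \<open>Only the coordinate functions of the target are tested; continuity and pullback of
  regular functions are derived from this below. The domain \<open>U\<close> is kept apart from
  \<open>S\<close> because the local sections exist only on charts.\<close>

definition regular_map ::
  "('a \<Rightarrow> complex) set \<Rightarrow> 'a set \<Rightarrow> 'a set \<Rightarrow> ('b \<Rightarrow> complex) set \<Rightarrow> 'b set \<Rightarrow> ('a \<Rightarrow> 'b) \<Rightarrow> bool"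
  where "regular_map X S U X' S' f \<longleftrightarrow>
    sub_open X S U \<and> f ` U \<subseteq> S' \<and> (\<forall>c\<in>X'. c \<circ> f \<in> sub_reg X S U)"

lemma regular_map_polynomial:
  assumes f: "regular_map X S U X' S' f" and "p \<in> polynomials X'"
  shows "p \<circ> f \<in> sub_reg X S U"
  using assms(2)
proof induction
  case (coord c)
  then show ?case using f unfolding regular_map_def by blast
next
  case (const c)
  then show ?case using f by (simp add: regular_map_def o_def sub_reg_const)
next
  case (add p q)
  then show ?case by (simp add: o_def sub_reg_add)
next
  case (mult p q)
  then show ?case by (simp add: o_def sub_reg_mult)
qed

text \<open>Principal open sets form a basis, and the preimage of \<open>{y. p y \<noteq> 0}\<close>
  is the nonvanishing locus of the regular function \<open>p \<circ> f\<close>.\<close>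

lemma regular_map_continuous:
  assumes f: "regular_map X S U X' S' f" and V: "sub_open X' S' V"
  shows "sub_open X S {x \<in> U. f x \<in> V}"
proof (subst openin_subopen, intro ballI)
  fix x assume x: "x \<in> {x \<in> U. f x \<in> V}"
  obtain V' where V': "zariski_open X' V'" "V = V' \<inter> S'"
    using V by (auto simp: openin_subtopology openin_zariski)
  with x have "f x \<in> V'" by blast
  with V'(1) obtain p where p: "p \<in> polynomials X'" "p (f x) \<noteq> 0" "{y. p y \<noteq> 0} \<subseteq> V'"
    unfolding zariski_open_iff by blast
  have "sub_open X S {x \<in> U. (p \<circ> f) x \<noteq> 0}"
    by (intro sub_open_nonzero regular_map_polynomial[OF f] p)
  then show "\<exists>T. sub_open X S T \<and> x \<in> T \<and> T \<subseteq> {x \<in> U. f x \<in> V}"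
    using f p x V' by (intro exI[of _ "{x \<in> U. (p \<circ> f) x \<noteq> 0}"]) (auto simp: regular_map_def)
qed

text \<open>Where \<open>h = p / q\<close>, the composite is the product of
  \<open>p \<circ> f\<close> with the inverse of \<open>q \<circ> f\<close>; these pieces are then
  glued.\<close>

lemma regular_map_comp:
  assumes f: "regular_map X S U X' S' f" and h: "h \<in> sub_reg X' S' V"
  shows "h \<circ> f \<in> sub_reg X S {x \<in> U. f x \<in> V}"
proof (rule sub_reg_local)
  fix x assume x: "x \<in> {x \<in> U. f x \<in> V}"
  then have "f x \<in> V" by simp
  with h obtain V' p q where 1: "sub_open X' S' V'" "f x \<in> V'" "V' \<subseteq> V" "p \<in> polynomials X'"
    "q \<in> polynomials X'" "\<forall>y\<in>V'. q y \<noteq> 0 \<and> h y = p y / q y"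
    by (rule sub_regE)
  define U' where "U' = {x \<in> U. f x \<in> V'}"
  have U': "sub_open X S U'" unfolding U'_def by (rule regular_map_continuous[OF f 1(1)])
  have pq: "p \<circ> f \<in> sub_reg X S U'" "q \<circ> f \<in> sub_reg X S U'"
    by (rule sub_reg_mono[OF regular_map_polynomial[OF f] U']; use 1 in \<open>force simp: U'_def\<close>)+
  have "(\<lambda>x. (p \<circ> f) x * inverse ((q \<circ> f) x)) \<in> sub_reg X S U'"
    by (intro sub_reg_mult sub_reg_inverse pq) (simp add: U'_def 1)
  then have "h \<circ> f \<in> sub_reg X S U'"
    by (rule sub_reg_cong) (simp add: U'_def 1 divide_inverse)
  then show "\<exists>V'. x \<in> V' \<and> V' \<subseteq> {x \<in> U. f x \<in> V} \<and> h \<circ> f \<in> sub_reg X S V'"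
    by (intro exI[of _ U']) (use x 1 in \<open>auto simp: U'_def\<close>)
qed

section \<open>Derivations along maps\<close>

text \<open>The germ version of a morphism. Pushforward of tangent vectors sees only germs at
  \<open>x\<close>, and a composite such as a local section after \<open>phi\<close> is well behaved
  only near the point in question.\<close>

definition morphism_at :: "'a fspace \<Rightarrow> 'b fspace \<Rightarrow> ('a \<Rightarrow> 'b) \<Rightarrow> 'a \<Rightarrow> bool"
  where "morphism_at M N f x \<longleftrightarrow>
    (\<forall>V. openin (topo N) V \<and> f x \<in> V \<longrightarrow> (\<exists>U. openin (topo M) U \<and> x \<in> U \<and> f ` U \<subseteq> V)) \<and>
    (\<forall>h\<in>germs N (f x). h \<circ> f \<in> germs M x)"

lemma morphism_at_open:
  assumes "morphism_at M N f x" "openin (topo N) V" "f x \<in> V"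
  obtains U where "openin (topo M) U" "x \<in> U" "f ` U \<subseteq> V"
  using assms unfolding morphism_at_def by blast

lemma morphism_at_germs: "morphism_at M N f x \<Longrightarrow> h \<in> germs N (f x) \<Longrightarrow> h \<circ> f \<in> germs M x"
  unfolding morphism_at_def by blast

lemma morphism_at_comp:
  assumes f: "morphism_at M N f x" and g: "morphism_at N K g (f x)"
  shows "morphism_at M K (g \<circ> f) x"
  unfolding morphism_at_def
proof (intro conjI allI impI ballI)
  fix V assume "openin (topo K) V \<and> (g \<circ> f) x \<in> V"
  then have "openin (topo K) V" "g (f x) \<in> V" by simp_all
  with g obtain U where U: "openin (topo N) U" "f x \<in> U" "g ` U \<subseteq> V"
    by (rule morphism_at_open)
  from f U(1,2) obtain U' where "openin (topo M) U'" "x \<in> U'" "f ` U' \<subseteq> U"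
    by (rule morphism_at_open)
  with U(3) show "\<exists>U. openin (topo M) U \<and> x \<in> U \<and> (g \<circ> f) ` U \<subseteq> V"
    by (intro exI[of _ U']) (auto simp: subset_iff image_iff)
next
  fix h assume "h \<in> germs K ((g \<circ> f) x)"
  then have "h \<circ> g \<in> germs N (f x)" by (intro morphism_at_germs[OF g]) simp
  from morphism_at_germs[OF f this] show "h \<circ> (g \<circ> f) \<in> germs M x"
    by (simp only: o_assoc)
qed

lemma morphism_at_morphism:
  assumes f: "morphism M N f" and x: "x \<in> points M"
  shows "morphism_at M N f x"
proof -
  have pre: "openin (topo M) {x \<in> points M. f x \<in> V}" if "openin (topo N) V" for V
    using f that unfolding morphism_def continuous_map_def by blast
  show ?thesis
    unfolding morphism_at_def
  proof (intro conjI allI impI ballI)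
    fix V assume "openin (topo N) V \<and> f x \<in> V"
    then show "\<exists>U. openin (topo M) U \<and> x \<in> U \<and> f ` U \<subseteq> V"
      using pre x by (intro exI[of _ "{x \<in> points M. f x \<in> V}"]) auto
  next
    fix h assume "h \<in> germs N (f x)"
    then obtain V where V: "openin (topo N) V" "f x \<in> V" "h \<in> reg N V"
      unfolding germs_def by blast
    then have "h \<circ> f \<in> reg M {x \<in> points M. f x \<in> V}" using f unfolding morphism_def by blast
    with V pre[OF V(1)] x show "h \<circ> f \<in> germs M x"
      unfolding germs_def mem_Collect_eq by (intro exI[of _ "{x \<in> points M. f x \<in> V}"]) auto
  qed
qed

lemma morphism_at_regular_map:
  assumes f: "regular_map X S U X' S' f" and x: "x \<in> U"
  shows "morphism_at (subvariety X S) (subvariety X' S') f x"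
  unfolding morphism_at_def topo_subvariety
proof (intro conjI allI impI ballI)
  fix V assume V: "sub_open X' S' V \<and> f x \<in> V"
  then show "\<exists>U. sub_open X S U \<and> x \<in> U \<and> f ` U \<subseteq> V"
    using regular_map_continuous[OF f, of V] x by (intro exI[of _ "{x \<in> U. f x \<in> V}"]) auto
next
  fix h assume "h \<in> germs (subvariety X' S') (f x)"
  then obtain V where V: "sub_open X' S' V" "f x \<in> V" "h \<in> sub_reg X' S' V"
    unfolding germs_def by auto
  then show "h \<circ> f \<in> germs (subvariety X S) x"
    unfolding germs_def topo_subvariety mem_Collect_eq
    using regular_map_continuous[OF f V(1)] regular_map_comp[OF f V(3)] x
    by (intro exI[of _ "{x \<in> U. f x \<in> V}"]) auto
qed

lemma morphism_quotient_space: "morphism M (quotient_space M \<pi>) \<pi>"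
  unfolding morphism_def
proof (intro conjI allI impI)
  show "continuous_map (topo M) (topo (quotient_space M \<pi>)) \<pi>"
    by (rule quotient_imp_continuous_map[OF quotient_map_quotient_space])
qed (simp add: quotient_space_def)

section \<open>Germs on a subvariety form an algebra\<close>

lemma germs_subvarietyI:
  "sub_open X S U \<Longrightarrow> x \<in> U \<Longrightarrow> f \<in> sub_reg X S U \<Longrightarrow> f \<in> germs (subvariety X S) x"
  unfolding germs_def topo_subvariety by blast

lemma germs_subvariety2:
  assumes "f \<in> germs (subvariety X S) x" "g \<in> germs (subvariety X S) x"
  obtains U where "sub_open X S U" "x \<in> U" "f \<in> sub_reg X S U" "g \<in> sub_reg X S U"
proof -
  obtain U V where U: "sub_open X S U" "x \<in> U" "f \<in> sub_reg X S U"
    and V: "sub_open X S V" "x \<in> V" "g \<in> sub_reg X S V"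
    using assms unfolding germs_def topo_subvariety by blast
  have UV: "sub_open X S (U \<inter> V)" using U V by blast
  show thesis
    using U V by (intro that[OF UV] sub_reg_mono[OF _ UV]) auto
qed

lemma germs_add:
  assumes "f \<in> germs (subvariety X S) x" "g \<in> germs (subvariety X S) x"
  shows "(\<lambda>y. f y + g y) \<in> germs (subvariety X S) x"
  using assms by (rule germs_subvariety2) (blast intro: germs_subvarietyI sub_reg_add)

lemma germs_mult:
  assumes "f \<in> germs (subvariety X S) x" "g \<in> germs (subvariety X S) x"
  shows "(\<lambda>y. f y * g y) \<in> germs (subvariety X S) x"
  using assms by (rule germs_subvariety2) (blast intro: germs_subvarietyI sub_reg_mult)

lemma germs_const:
  assumes "x \<in> S"
  shows "(\<lambda>_. c) \<in> germs (subvariety X S) x"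
proof -
  show ?thesis by (rule germs_subvarietyI[OF sub_open_self assms sub_reg_const[OF sub_open_self]])
qed

lemma germs_scale:
  assumes "f \<in> germs (subvariety X S) x"
  shows "(\<lambda>y. c * f y) \<in> germs (subvariety X S) x"
proof -
  have "x \<in> S" using assms by (auto simp: germs_def dest!: openin_subset)
  then show ?thesis by (intro germs_mult germs_const assms)
qed

lemma germs_sum:
  assumes "\<And>i. i \<in> I \<Longrightarrow> f i \<in> germs (subvariety X S) x" "x \<in> S"
  shows "(\<lambda>y. \<Sum>i\<in>I. f i y) \<in> germs (subvariety X S) x"
  using assms
  by (induction I rule: infinite_finite_induct) (simp_all add: germs_const germs_add)

section \<open>Calculus of derivations\<close>

lemma tangent_cong:
  "D \<in> tangent M x \<Longrightarrow> f \<in> germs M x \<Longrightarrow> g \<in> germs M x \<Longrightarrow> openin (topo M) U \<Longrightarrow> x \<in> U \<Longrightarrow>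
    (\<And>y. y \<in> U \<Longrightarrow> f y = g y) \<Longrightarrow> D f = D g"
  unfolding tangent_def by blast

lemma tangent_add:
  "D \<in> tangent M x \<Longrightarrow> f \<in> germs M x \<Longrightarrow> g \<in> germs M x \<Longrightarrow> D (\<lambda>y. f y + g y) = D f + D g"
  unfolding tangent_def by blast

lemma tangent_scale:
  "D \<in> tangent M x \<Longrightarrow> f \<in> germs M x \<Longrightarrow> D (\<lambda>y. c * f y) = c * D f"
  unfolding tangent_def by blast

lemma tangent_mult:
  "D \<in> tangent M x \<Longrightarrow> f \<in> germs M x \<Longrightarrow> g \<in> germs M x \<Longrightarrow>
    D (\<lambda>y. f y * g y) = f x * D g + g x * D f"
  unfolding tangent_def by blast

lemma tangent_extensional: "D \<in> tangent M x \<Longrightarrow> D \<in> extensional (germs M x)"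
  unfolding tangent_def by blast

lemma tangent_const:
  assumes D: "D \<in> tangent (subvariety X S) x" and x: "x \<in> S"
  shows "D (\<lambda>_. c) = 0"
proof -
  have one: "(\<lambda>_. 1) \<in> germs (subvariety X S) x" by (rule germs_const[OF x])
  \<comment> \<open>The Leibniz rule for \<open>1 * 1\<close> reads
    \<open>D 1 = D 1 + D 1\<close>.\<close>
  have "D (\<lambda>_. 1) = 0" using tangent_mult[OF D one one] by simp
  then show ?thesis using tangent_scale[OF D one, of c] by simp
qed

lemma tangent_sum:
  assumes "D \<in> tangent (subvariety X S) x" "x \<in> S"
    and "\<And>i. i \<in> I \<Longrightarrow> f i \<in> germs (subvariety X S) x"
  shows "D (\<lambda>y. \<Sum>i\<in>I. f i y) = (\<Sum>i\<in>I. D (f i))"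
  using assms(3)
proof (induction I rule: infinite_finite_induct)
  case (insert i I)
  have "D (\<lambda>y. f i y + (\<Sum>j\<in>I. f j y)) = D (f i) + D (\<lambda>y. \<Sum>j\<in>I. f j y)"
    by (intro tangent_add[OF assms(1)] germs_sum assms(2)) (simp_all add: insert.prems)
  with insert show ?case by simp
qed (simp_all add: tangent_const[OF assms(1,2)])

section \<open>Pushforward: chain rule, locality, tangency\<close>

lemma pushforward_apply: "h \<in> germs N (f x) \<Longrightarrow> pushforward N f x D h = D (h \<circ> f)"
  by (simp add: pushforward_def)

lemma pushforward_comp:
  assumes "morphism_at N K g (f x)"
  shows "pushforward K g (f x) (pushforward N f x D) = pushforward K (g \<circ> f) x D"
proof
  fix h
  show "pushforward K g (f x) (pushforward N f x D) h = pushforward K (g \<circ> f) x D h"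
  \<comment> \<open>Off \<open>germs K (g (f x))\<close> both sides take the default value
    \<open>undefined\<close>.\<close>
  proof (cases "h \<in> germs K (g (f x))")
    case True
    then show ?thesis
      using morphism_at_germs[OF assms True] by (simp add: pushforward_apply o_assoc)
  qed (simp add: pushforward_def)
qed

text \<open>Identities between maps that hold only on a neighbourhood of \<open>x\<close> reach
  tangent vectors through this lemma, since a derivation depends only on germs.\<close>

lemma pushforward_cong:
  assumes D: "D \<in> tangent M x" and f: "morphism_at M N f x" and g: "morphism_at M N g x"
    and U: "openin (topo M) U" "x \<in> U" "\<And>y. y \<in> U \<Longrightarrow> f y = g y"
  shows "pushforward N f x D = pushforward N g x D"
proof
  fix h
  have eq: "f x = g x" using U by blast
  show "pushforward N f x D h = pushforward N g x D h"
  proof (cases "h \<in> germs N (f x)")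
    case True
    then have "h \<circ> f \<in> germs M x" "h \<circ> g \<in> germs M x"
      using morphism_at_germs[OF f] morphism_at_germs[OF g] eq by auto
    then have "D (h \<circ> f) = D (h \<circ> g)" by (rule tangent_cong[OF D _ _ U(1,2)]) (simp add: U)
    with True eq show ?thesis by (simp add: pushforward_apply)
  qed (simp add: pushforward_def eq)
qed

lemma pushforward_id:
  assumes "D \<in> tangent M x"
  shows "pushforward M id x D = D"
  using tangent_extensional[OF assms] by (simp add: pushforward_def extensional_restrict)

text \<open>Composition with \<open>f\<close> respects sums, scalars and products, so the derivation
  laws carry over. The target is a subvariety because there germs are known to be closed under these
  operations; the source is arbitrary, so that vectors on the torus quotient are covered.\<close>

lemma pushforward_tangent:
  assumes D: "D \<in> tangent M x" and f: "morphism_at M (subvariety X S) f x"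
  shows "pushforward (subvariety X S) f x D \<in> tangent (subvariety X S) (f x)"
proof -
  let ?N = "subvariety X S" and ?D = "pushforward (subvariety X S) f x D"
  note germ = morphism_at_germs[OF f] and app = pushforward_apply
  show ?thesis
    unfolding tangent_def mem_Collect_eq
  proof (intro conjI ballI allI impI)
    show "?D \<in> extensional (germs ?N (f x))" by (simp add: pushforward_def)
  next
    fix h k U assume hk: "h \<in> germs ?N (f x)" "k \<in> germs ?N (f x)"
      and U: "openin (topo ?N) U \<and> f x \<in> U \<and> (\<forall>y\<in>U. h y = k y)"
    then have "openin (topo ?N) U" "f x \<in> U" by simp_all
    with f obtain V where V: "openin (topo M) V" "x \<in> V" "f ` V \<subseteq> U"
      by (rule morphism_at_open)
    have "D (h \<circ> f) = D (k \<circ> f)"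
      by (rule tangent_cong[OF D germ germ V(1,2)]) (use hk U V(3) in auto)
    then show "?D h = ?D k" by (simp add: app hk)
  next
    fix h k assume hk: "h \<in> germs ?N (f x)" "k \<in> germs ?N (f x)"
    show "?D (\<lambda>y. h y + k y) = ?D h + ?D k"
      using tangent_add[OF D germ[OF hk(1)] germ[OF hk(2)]]
      by (simp add: app hk germs_add o_def)
    show "?D (\<lambda>y. h y * k y) = h (f x) * ?D k + k (f x) * ?D h"
      using tangent_mult[OF D germ[OF hk(1)] germ[OF hk(2)]]
      by (simp add: app hk germs_mult o_def)
  next
    fix c h assume h: "h \<in> germs ?N (f x)"
    show "?D (\<lambda>y. c * h y) = c * ?D h"
      using tangent_scale[OF D germ[OF h], of c] by (simp add: app h germs_scale o_def)
  qed
qed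

lemma matrix_d_mult:
  fixes F H :: "'a \<Rightarrow> 'n::finite cmat"
  assumes D: "D \<in> tangent (subvariety X S) x" and x: "x \<in> S"
    and F: "\<And>i j. (\<lambda>y. F y $ i $ j) \<in> germs (subvariety X S) x"
    and H: "\<And>i j. (\<lambda>y. H y $ i $ j) \<in> germs (subvariety X S) x"
  shows "matrix_d (\<lambda>y. F y ** H y) D = matrix_d F D ** H x + F x ** matrix_d H D"
proof -
  have "D (\<lambda>y. (F y ** H y) $ i $ j)
      = (\<Sum>k\<in>UNIV. D (\<lambda>y. F y $ i $ k) * H x $ k $ j + F x $ i $ k * D (\<lambda>y. H y $ k $ j))" for i j
    unfolding matrix_matrix_mult_def vec_lambda_beta
    by (subst tangent_sum[OF D x germs_mult[OF F H]])
       (simp_all add: tangent_mult[OF D F H] algebra_simps)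
  then show ?thesis
    by (simp add: matrix_d_def matrix_matrix_mult_def vec_eq_iff sum.distrib)
qed

section \<open>Systems of rank one projectors\<close>

text \<open>The product of a row with a column: bilinear, without conjugation, since the projectors
  need not be Hermitian.\<close>

definition pairing :: "complex^'n::finite \<Rightarrow> complex^'n \<Rightarrow> complex"
  where "pairing v u = (\<Sum>k\<in>UNIV. v $ k * u $ k)"

definition outer :: "complex^'n::finite \<Rightarrow> complex^'n \<Rightarrow> 'n cmat"
  where "outer u v = (\<chi> j k. u $ j * v $ k)"

lemma outer_entry [simp]: "outer u v $ j $ k = u $ j * v $ k"
  by (simp add: outer_def)

lemma outer_mult: "outer u v ** outer w z = outer (pairing v w *s u) z"
  by (simp add: vec_eq_iff matrix_matrix_mult_def pairing_def sum_distrib_left sum_distrib_right mult_ac)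

lemma trace_outer: "trace (outer u v) = pairing v u"
  by (simp add: trace_def pairing_def mult.commute)

lemma pairing_scale: "pairing v (c *s u) = c * pairing v u"
  by (simp add: pairing_def sum_distrib_left mult_ac)

lemma pairing_minus: "pairing v (- u) = - pairing v u"
  by (simp add: pairing_def sum_negf)

text \<open>Rank one puts all rows on a line spanned by some \<open>v\<close>, so
  \<open>p = outer u v\<close>. Then \<open>p ** p\<close> is \<open>p\<close> scaled by
  \<open>pairing v u\<close>, and comparison at a nonzero entry makes this scalar 1.\<close>

lemma rank1_projector_iff:
  "p \<in> rank1_projectors \<longleftrightarrow> (\<exists>u v. p = outer u v \<and> pairing v u = 1)"
proof
  assume p: "p \<in> rank1_projectors"
  then have idem: "p ** p = p" and rk: "vec.dim (rows p) = 1" and "p \<noteq> 0"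
    using rank1_nonzero by (auto simp: rank1_projectors_def projector_def row_rank_def_gen)
  obtain B where B: "rows p \<subseteq> vec.span B" "card B = 1"
    using vec.basis_exists[of "rows p"] rk by metis
  then obtain v where "B = {v}" by (meson card_1_singletonE)
  then have "\<forall>j. \<exists>c. p $ j = c *s v"
    using B(1) by (auto simp: rows_def row_def vec.span_singleton)
  then obtain c where c: "\<And>j. p $ j = c j *s v" by metis
  define u where "u = (\<chi> j. c j)"
  have pu: "p = outer u v" by (simp add: vec_eq_iff c u_def)
  obtain j k where jk: "u $ j * v $ k \<noteq> 0"
    using \<open>p \<noteq> 0\<close> by (auto simp: vec_eq_iff pu)
  have "outer (pairing v u *s u) v $ j $ k = outer u v $ j $ k"
    using idem by (simp add: pu outer_mult)
  then have "pairing v u = 1" using jk by simp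
  with pu show "\<exists>u v. p = outer u v \<and> pairing v u = 1" by blast
next
  assume "\<exists>u v. p = outer u v \<and> pairing v u = 1"
  then obtain u v where p: "p = outer u v" "pairing v u = 1" by blast
  then have "u \<noteq> 0" "v \<noteq> 0" by (auto simp: pairing_def)
  then have "rank p = 1" unfolding p outer_def by (rule rank_outer)
  then show "p \<in> rank1_projectors"
    using p by (simp add: rank1_projectors_def projector_def outer_mult)
qed

lemma matrix_add_rdistrib: "(A + B) ** C = A ** C + B ** (C :: 'n::finite cmat)"
  by (simp add: vec_eq_iff matrix_matrix_mult_def distrib_right sum.distrib)

text \<open>The rows of \<open>coframe (g, A)\<close> are the \<open>b\<^sub>i\<close> in the factorisation \<open>r\<^sub>i = u\<^sub>i b\<^sub>i\<close>.\<close>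

definition coframe :: "'n::finite cmat \<times> 'n cmat \<Rightarrow> 'n cmat"
  where "coframe x = matrix_inv (fst x) + snd x"

lemma mu_T_zero_iff:
  "x \<in> mu_T_zero \<longleftrightarrow> invertible (fst x) \<and> (\<forall>i. (snd x ** fst x) $ i $ i = 0)"
  by (cases x) (auto simp: mu_T_zero_def GL_def mu_T_def diag_part_def vec_eq_iff)

text \<open>Moving \<open>g^-1\<close> into the last factor turns
  \<open>g q_i g^-1 (1 + g A)\<close> into \<open>g q_i (g^-1 + A)\<close>, and \<open>q_i\<close>
  selects column \<open>i\<close> on its left and row \<open>i\<close> on its right.\<close>

lemma phi_rep_eq_outer:
  assumes "invertible (fst x)"
  shows "phi_rep x $ i = outer (column i (fst x)) (coframe x $ i)"
proof -
  obtain g A where x: "x = (g, A)" by (cases x)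
  have "matrix_inv g ** (mat 1 + g ** A) = matrix_inv g + (matrix_inv g ** g) ** A"
    by (simp add: matrix_add_ldistrib matrix_mul_assoc)
  also have "\<dots> = coframe x"
    using assms by (simp add: x coframe_def matrix_inv_props)
  finally have "phi_rep x $ i = (g ** coord_proj i) ** coframe x"
    by (simp add: x phi_rep_def projector_system_def matrix_mul_assoc[symmetric])
  also have "\<dots> = outer (column i g) (coframe x $ i)"
  proof -
    have "((g ** coord_proj i) ** coframe x) $ j $ k = g $ j $ i * coframe x $ i $ k" for j k
    proof -
      have "((g ** coord_proj i) ** coframe x) $ j $ k
          = (\<Sum>l\<in>UNIV. (g ** coord_proj i) $ j $ l * coframe x $ l $ k)"
        by (simp add: matrix_matrix_mult_def[of "g ** coord_proj i"])
      also have "\<dots> = (\<Sum>l\<in>UNIV. if l = i then g $ j $ i * coframe x $ l $ k else 0)"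
        unfolding matrix_mult_coord_proj by (intro sum.cong) auto
      finally show ?thesis by simp
    qed
    then show ?thesis by (simp add: vec_eq_iff column_def)
  qed
  finally show ?thesis by (simp add: x)
qed

lemma phi_rep_entry:
  "invertible (fst x) \<Longrightarrow> phi_rep x $ i $ j $ k = fst x $ j $ i * coframe x $ i $ k"
  by (simp add: phi_rep_eq_outer column_def)

text \<open>The moment map equation in terms of the coframe: \<open>(g^-1 + A) g = 1 + A g\<close>,
  and \<open>A g\<close> has zero diagonal.\<close>

lemma coframe_mult_entry:
  assumes "x \<in> mu_T_zero"
  shows "(coframe x ** fst x) $ i $ i = 1"
proof -
  have "coframe x ** fst x = mat 1 + snd x ** fst x"
    using assms by (simp add: coframe_def matrix_add_rdistrib matrix_inv_props mu_T_zero_iff)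
  then show ?thesis using assms by (simp add: mu_T_zero_iff mat_def)
qed

lemma pairing_coframe:
  "x \<in> mu_T_zero \<Longrightarrow> pairing (coframe x $ i) (column i (fst x)) = 1"
  using coframe_mult_entry[of x i] by (simp add: pairing_def column_def matrix_matrix_mult_def)

lemma phi_rep_in_Y:
  assumes "x \<in> mu_T_zero"
  shows "phi_rep x \<in> Y_set"
  unfolding Y_set_def mem_Collect_eq rank1_projector_iff
  using assms pairing_coframe[OF assms] phi_rep_eq_outer[of x] by (auto simp: mu_T_zero_iff)

section \<open>Diagonal matrices and torus orbits\<close>

definition diag_mat :: "('n \<Rightarrow> complex) \<Rightarrow> 'n::finite cmat"
  where "diag_mat c = (\<chi> i j. if i = j then c i else 0)"

lemma mult_diag_mat: "(A ** diag_mat c) $ i $ j = A $ i $ j * c j"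
proof -
  have "(A ** diag_mat c) $ i $ j = (\<Sum>k\<in>UNIV. if k = j then A $ i $ k * c k else 0)"
    unfolding matrix_matrix_mult_def diag_mat_def vec_lambda_beta by (intro sum.cong) auto
  then show ?thesis by simp
qed

lemma diag_mat_mult: "(diag_mat c ** A) $ i $ j = c i * A $ i $ j"
proof -
  have "(diag_mat c ** A) $ i $ j = (\<Sum>k\<in>UNIV. if k = i then c k * A $ k $ j else 0)"
    unfolding matrix_matrix_mult_def diag_mat_def vec_lambda_beta by (intro sum.cong) auto
  then show ?thesis by simp
qed

lemma diag_mat_mult_diag_mat: "diag_mat c ** diag_mat d = diag_mat (\<lambda>i. c i * d i)"
  by (simp add: vec_eq_iff diag_mat_mult) (simp add: diag_mat_def)

lemma diag_mat_inverse:
  assumes "\<And>i. c i \<noteq> 0"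
  shows "diag_mat c ** diag_mat (\<lambda>i. inverse (c i)) = mat 1"
  using assms by (simp add: diag_mat_mult_diag_mat) (simp add: diag_mat_def mat_def)

lemma invertible_diag_mat:
  assumes "\<And>i. c i \<noteq> 0"
  shows "invertible (diag_mat c)" "matrix_inv (diag_mat c) = diag_mat (\<lambda>i. inverse (c i))"
proof -
  have 1: "diag_mat c ** diag_mat (\<lambda>i. inverse (c i)) = mat 1"
    using assms by (rule diag_mat_inverse)
  have 2: "diag_mat (\<lambda>i. inverse (c i)) ** diag_mat c = mat 1"
    using diag_mat_inverse[of "\<lambda>i. inverse (c i)"] assms by simp
  show "invertible (diag_mat c)" using 1 2 unfolding invertible_def by blast
  show "matrix_inv (diag_mat c) = diag_mat (\<lambda>i. inverse (c i))"
    using 1 2 by (rule matrix_inv_eqI)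
qed

lemma diag_part_diag_mat: "diag_part (diag_mat c) = diag_mat c"
  by (simp add: diag_part_def diag_mat_def vec_eq_iff)

lemma torusE:
  assumes "t \<in> torus"
  obtains c where "t = diag_mat c"
proof
  have "t = diag_part t" using assms by (simp add: torus_def)
  also have "\<dots> = diag_mat (\<lambda>i. t $ i $ i)"
    by (simp add: vec_eq_iff diag_part_def diag_mat_def)
  finally show "t = diag_mat (\<lambda>i. t $ i $ i)" .
qed

lemma diag_mat_torus: "(\<And>i. c i \<noteq> 0) \<Longrightarrow> diag_mat c \<in> torus"
  by (simp add: torus_def GL_def invertible_diag_mat(1) diag_part_diag_mat)

lemma torus_mult:
  assumes "s \<in> torus" "t \<in> torus"
  shows "s ** t \<in> torus"
proof -
  obtain c d where "s = diag_mat c" "t = diag_mat d" using assms by (metis torusE)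
  then have "diag_part (s ** t) = s ** t"
    by (simp add: diag_mat_mult_diag_mat diag_part_diag_mat)
  then show ?thesis
    using assms invertible_mult[of s t] by (simp add: torus_def GL_def)
qed

lemma torus_act_act:
  assumes "s \<in> torus" "t \<in> torus"
  shows "torus_act s (torus_act t x) = torus_act (s ** t) x"
proof -
  have st: "invertible s" "invertible t" using assms by (auto simp: torus_def GL_def)
  have "matrix_inv (s ** t) = matrix_inv t ** matrix_inv s"
  proof (rule matrix_inv_eqI)
    have "s ** t ** (matrix_inv t ** matrix_inv s) = s ** (t ** matrix_inv t) ** matrix_inv s"
      by (simp only: matrix_mul_assoc)
    then show "s ** t ** (matrix_inv t ** matrix_inv s) = mat 1"
      by (simp add: matrix_inv_props st)
    have "matrix_inv t ** matrix_inv s ** (s ** t) = matrix_inv t ** (matrix_inv s ** s) ** t"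
      by (simp only: matrix_mul_assoc)
    then show "matrix_inv t ** matrix_inv s ** (s ** t) = mat 1"
      by (simp add: matrix_inv_props st)
  qed
  then show ?thesis by (simp add: torus_act_def split_beta matrix_mul_assoc)
qed

lemma torus_orbit_act_subset:
  assumes t: "t \<in> torus"
  shows "torus_orbit (torus_act t x) \<subseteq> torus_orbit x"
proof
  fix y assume "y \<in> torus_orbit (torus_act t x)"
  then obtain s where s: "s \<in> torus" "y = torus_act s (torus_act t x)"
    unfolding torus_orbit_def by blast
  then have "y = torus_act (s ** t) x" by (simp only: torus_act_act t)
  with torus_mult[OF s(1) t] show "y \<in> torus_orbit x" unfolding torus_orbit_def by blast
qed

text \<open>
  \<open>r\<^sub>i = u\<^sub>i b\<^sub>i\<close> with \<open>b\<^sub>i u\<^sub>i = 1\<close> determines \<open>u\<^sub>i\<close> and \<open>b\<^sub>i\<close> up to inverse scalars, so the torus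
  element relating two representatives is read off from the mixed pairings.
\<close>

lemma phi_rep_eqD:
  assumes x: "x \<in> mu_T_zero" and y: "y \<in> mu_T_zero" and eq: "phi_rep x = phi_rep y"
  shows "\<exists>t\<in>torus. y = torus_act t x"
proof -
  have inv: "invertible (fst x)" "invertible (fst y)" using x y by (auto simp: mu_T_zero_iff)
  define c where "c i = pairing (coframe x $ i) (column i (fst y))" for i
  have ent: "fst x $ j $ i * coframe x $ i $ k = fst y $ j $ i * coframe y $ i $ k" for i j k
    by (simp add: phi_rep_entry[OF inv(1), symmetric] phi_rep_entry[OF inv(2), symmetric] eq)
  \<comment> \<open>Apply \<open>r_i\<close> to the \<open>i\<close>-th column of
    \<open>fst y\<close>: one factorisation returns that column, the other gives \<open>c i\<close>
    times the \<open>i\<close>-th column of \<open>fst x\<close>.\<close>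
  have g: "fst y $ j $ i = fst x $ j $ i * c i" for i j
  proof -
    have "fst x $ j $ i * c i
        = (\<Sum>k\<in>UNIV. (fst x $ j $ i * coframe x $ i $ k) * fst y $ k $ i)"
      by (simp add: c_def pairing_def column_def sum_distrib_left mult.assoc)
    also have "\<dots> = fst y $ j $ i * pairing (coframe y $ i) (column i (fst y))"
      unfolding ent by (simp add: pairing_def column_def sum_distrib_left mult.assoc)
    finally show ?thesis by (simp add: pairing_coframe[OF y])
  qed
  \<comment> \<open>Dually, multiply \<open>r_i\<close> on the left by the \<open>i\<close>-th row
    of \<open>coframe x\<close>.\<close>
  have b: "coframe x $ i $ k = c i * coframe y $ i $ k" for i k
  proof -
    have "c i * coframe y $ i $ k
        = (\<Sum>j\<in>UNIV. coframe x $ i $ j * (fst y $ j $ i * coframe y $ i $ k))"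
      by (simp add: c_def pairing_def column_def sum_distrib_right mult.assoc)
    also have "\<dots> = pairing (coframe x $ i) (column i (fst x)) * coframe x $ i $ k"
      unfolding ent[symmetric] by (simp add: pairing_def column_def sum_distrib_right mult.assoc)
    finally show ?thesis by (simp add: pairing_coframe[OF x])
  qed
  \<comment> \<open>Otherwise row \<open>i\<close> of \<open>coframe x\<close> would vanish,
    although it pairs to 1 with a column of \<open>fst x\<close>.\<close>
  have c: "c i \<noteq> 0" for i
    using pairing_coframe[OF x, of i] unfolding pairing_def b by auto
  \<comment> \<open>The action multiplies \<open>g\<close> by the inverse of \<open>t\<close>, so
    \<open>t\<close> carries the inverse scalars.\<close>
  define t where "t = diag_mat (\<lambda>i. inverse (c i))"
  have t: "t \<in> torus" unfolding t_def by (rule diag_mat_torus) (simp add: c)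
  then have tinv: "invertible t" by (simp add: torus_def GL_def)
  have mt: "matrix_inv t = diag_mat c"
    unfolding t_def by (subst invertible_diag_mat(2)) (simp_all add: c)
  have gy: "fst y = fst x ** matrix_inv t"
    by (simp add: vec_eq_iff mt mult_diag_mat g)
  have "coframe y = t ** coframe x"
    by (simp add: vec_eq_iff t_def diag_mat_mult b c)
  moreover have "matrix_inv (fst y) = t ** matrix_inv (fst x)"
    unfolding gy by (rule matrix_inv_torus[OF inv(1) tinv])
  ultimately have "snd y = t ** snd x"
    by (simp add: coframe_def matrix_add_ldistrib)
  with gy have "y = torus_act t x" by (simp add: torus_act_def split_beta prod_eq_iff)
  with t show ?thesis by blast
qed

text \<open>Each of \<open>x\<close> and \<open>y\<close> is a torus translate of the other, so the
  two inclusions of orbits follow from one argument used twice.\<close>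

lemma torus_orbit_eq:
  assumes "x \<in> mu_T_zero" "y \<in> mu_T_zero" "phi_rep x = phi_rep y"
  shows "torus_orbit x = torus_orbit y"
proof
  from phi_rep_eqD[OF assms(2,1) assms(3)[symmetric]] torus_orbit_act_subset
  show "torus_orbit x \<subseteq> torus_orbit y" by blast
  from phi_rep_eqD[OF assms] torus_orbit_act_subset
  show "torus_orbit y \<subseteq> torus_orbit x" by blast
qed

section \<open>The image and local sections\<close>

definition frame :: "('n \<Rightarrow> 'n) \<Rightarrow> 'n::finite cmat^'n \<Rightarrow> 'n cmat"
  where "frame \<kappa> r = (\<chi> a b. r $ b $ a $ \<kappa> b)"

definition chart :: "('n \<Rightarrow> 'n) \<Rightarrow> ('n::finite cmat^'n) set"
  where "chart \<kappa> = {r \<in> Y_set. det (frame \<kappa> r) \<noteq> 0}"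

text \<open>
  On \<open>chart \<kappa>\<close> take for \<open>u\<^sub>i\<close> the column \<open>\<kappa> i\<close> of \<open>r\<^sub>i\<close>; then \<open>b\<^sub>i\<close> is the \<open>i\<close>-th row of \<open>g\<^sup>-\<^sup>1 r\<^sub>i\<close>.
\<close>

definition local_section :: "('n \<Rightarrow> 'n) \<Rightarrow> 'n::finite cmat^'n \<Rightarrow> 'n cmat \<times> 'n cmat"
  where "local_section \<kappa> r =
    (frame \<kappa> r,
     (\<chi> i k. (matrix_inv (frame \<kappa> r) ** r $ i) $ i $ k) - matrix_inv (frame \<kappa> r))"

text \<open>Write \<open>r_i = u_i v_i\<close>. Column \<open>i\<close> of the frame is
  \<open>u_i\<close> times the entry \<open>\<kappa> i\<close> of \<open>v_i\<close>; invertibility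
  of the frame makes this scalar nonzero. The coframe then has row \<open>v_i\<close> divided by
  that scalar, so both the product \<open>r_i\<close> and the pairing 1 are recovered.\<close>

lemma local_section:
  assumes r: "r \<in> chart \<kappa>"
  shows "local_section \<kappa> r \<in> mu_T_zero" "phi_rep (local_section \<kappa> r) = r"
proof -
  define g where "g = frame \<kappa> r"
  define s where "s = local_section \<kappa> r"
  have g: "invertible g" using r by (simp add: g_def chart_def invertible_det_nz)
  have "\<forall>i. \<exists>u v. r $ i = outer u v \<and> pairing v u = 1"
    using r by (simp add: chart_def Y_set_def rank1_projector_iff)
  then obtain u v where uv: "\<And>i. r $ i = outer (u i) (v i)" "\<And>i. pairing (v i) (u i) = 1"
    by metis
  have gu: "g $ j $ i = u i $ j * v i $ \<kappa> i" for i j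
    by (simp add: g_def frame_def uv)
  have gg: "(\<Sum>l\<in>UNIV. matrix_inv g $ i $ l * g $ l $ i) = 1" for i
  proof -
    have "(matrix_inv g ** g) $ i $ i = 1" by (simp add: matrix_inv_props g mat_def)
    then show ?thesis by (simp add: matrix_matrix_mult_def)
  qed
  have nz: "v i $ \<kappa> i \<noteq> 0" for i
    using gg[of i] unfolding gu by auto
  have fst_s: "fst s = g" by (simp add: s_def local_section_def g_def)
  have b: "coframe s $ i $ k = v i $ k / v i $ \<kappa> i" for i k
  proof -
    have "coframe s $ i $ k = (matrix_inv g ** r $ i) $ i $ k"
      by (simp add: coframe_def s_def local_section_def g_def)
    \<comment> \<open>Column \<open>k\<close> of \<open>r $ i\<close> is column \<open>i\<close> of
      \<open>g\<close> times \<open>v i $ k / v i $ \<kappa> i\<close>.\<close>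
    also have "\<dots> = (\<Sum>l\<in>UNIV. matrix_inv g $ i $ l * g $ l $ i) * (v i $ k / v i $ \<kappa> i)"
      unfolding matrix_matrix_mult_def vec_lambda_beta sum_distrib_right
      by (intro sum.cong) (simp_all add: uv gu nz)
    finally show ?thesis by (simp add: gg)
  qed
  have "(coframe s ** g) $ i $ i = 1" for i
    using uv(2)[of i] nz by (simp add: matrix_matrix_mult_def b gu pairing_def mult.commute)
  moreover have "coframe s ** g = mat 1 + snd s ** g"
    by (simp add: coframe_def fst_s matrix_add_rdistrib matrix_inv_props g)
  ultimately show "local_section \<kappa> r \<in> mu_T_zero"
    using g by (simp add: mu_T_zero_iff fst_s flip: s_def) (simp add: mat_def)
  have "phi_rep s $ i $ j $ k = r $ i $ j $ k" for i j k
    using nz g by (simp add: phi_rep_entry fst_s b gu uv)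
  then show "phi_rep (local_section \<kappa> r) = r"
    by (simp add: vec_eq_iff flip: s_def)
qed

text \<open>Each row of the coframe is nonzero because it pairs to 1 with a column. Let
  \<open>\<kappa>\<close> pick a nonzero entry in every row; the resulting frame is \<open>g\<close>
  with columns rescaled by these entries.\<close>

lemma phi_rep_in_chart:
  assumes x: "x \<in> mu_T_zero"
  shows "\<exists>\<kappa>. phi_rep x \<in> chart \<kappa>"
proof -
  have inv: "invertible (fst x)" using x by (simp add: mu_T_zero_iff)
  have "\<exists>k. coframe x $ i $ k \<noteq> 0" for i
    using pairing_coframe[OF x, of i] by (rule contrapos_pp) (simp add: pairing_def)
  then obtain \<kappa> where \<kappa>: "\<And>i. coframe x $ i $ \<kappa> i \<noteq> 0" by metis
  have "frame \<kappa> (phi_rep x) = fst x ** diag_mat (\<lambda>i. coframe x $ i $ \<kappa> i)"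
    by (simp add: vec_eq_iff mult_diag_mat frame_def phi_rep_entry inv)
  then have "invertible (frame \<kappa> (phi_rep x))"
    using inv by (simp add: invertible_mult invertible_diag_mat \<kappa>)
  then show ?thesis
    by (intro exI[of _ \<kappa>]) (simp add: chart_def phi_rep_in_Y[OF x] invertible_det_nz)
qed

lemma phi_rep_image: "phi_rep ` mu_T_zero = (\<Union>\<kappa>. chart \<kappa>)"
proof
  show "phi_rep ` mu_T_zero \<subseteq> (\<Union>\<kappa>. chart \<kappa>)" using phi_rep_in_chart by blast
  show "(\<Union>\<kappa>. chart \<kappa>) \<subseteq> phi_rep ` mu_T_zero"
  proof (rule UN_least, rule subsetI)
    fix \<kappa> r assume "r \<in> chart \<kappa>"
    from local_section[OF this] show "r \<in> phi_rep ` mu_T_zero" by (metis imageI)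
  qed
qed

section \<open>Regularity of \<open>phi_rep\<close> and of the local sections\<close>

lemma sub_reg_pair_coord:
  assumes "sub_open pair_coords S U"
  shows "(\<lambda>x. fst x $ i $ j) \<in> sub_reg pair_coords S U" "(\<lambda>x. snd x $ i $ j) \<in> sub_reg pair_coords S U"
  by (rule sub_reg_coord[OF _ assms]; force simp: pair_coords_def)+

lemma sub_reg_Y_coord:
  "sub_open Y_coords S U \<Longrightarrow> (\<lambda>r. r $ i $ j $ k) \<in> sub_reg Y_coords S U"
  by (rule sub_reg_coord) (auto simp: Y_coords_def)

lemma sub_reg_coframe:
  "(\<lambda>x. coframe x $ i $ j) \<in> sub_reg pair_coords mu_T_zero mu_T_zero"
  unfolding coframe_def vector_add_component
  by (intro sub_reg_add sub_reg_matrix_inv sub_reg_pair_coord sub_open_self)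
    (simp add: mu_T_zero_iff)

lemma regular_map_phi_rep:
  "regular_map pair_coords mu_T_zero mu_T_zero Y_coords Y_set phi_rep"
  unfolding regular_map_def
proof (intro conjI ballI sub_open_self)
  show "phi_rep ` mu_T_zero \<subseteq> Y_set" using phi_rep_in_Y by blast
  fix c :: "'a cmat^'a \<Rightarrow> complex" assume "c \<in> Y_coords"
  then obtain i j k where c: "c = (\<lambda>r. r $ i $ j $ k)" by (auto simp: Y_coords_def)
  have "(\<lambda>x. fst x $ j $ i * coframe x $ i $ k) \<in> sub_reg pair_coords mu_T_zero mu_T_zero"
    by (intro sub_reg_mult sub_reg_pair_coord sub_reg_coframe sub_open_self)
  then show "c \<circ> phi_rep \<in> sub_reg pair_coords mu_T_zero mu_T_zero"
    by (rule sub_reg_cong) (simp add: c phi_rep_entry mu_T_zero_iff)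
qed

lemma sub_open_chart: "sub_open Y_coords Y_set (chart \<kappa>)"
proof -
  have "(\<lambda>r. det (frame \<kappa> r)) \<in> sub_reg Y_coords Y_set Y_set"
    by (rule sub_reg_det) (simp_all add: frame_def sub_reg_Y_coord sub_open_self)
  from sub_open_nonzero[OF this] show ?thesis by (simp add: chart_def)
qed

lemma regular_map_local_section:
  "regular_map Y_coords Y_set (chart \<kappa>) pair_coords mu_T_zero (local_section \<kappa>)"
  unfolding regular_map_def
proof (intro conjI ballI sub_open_chart)
  show "local_section \<kappa> ` chart \<kappa> \<subseteq> mu_T_zero" using local_section(1) by blast
  have f: "(\<lambda>r. frame \<kappa> r $ i $ j) \<in> sub_reg Y_coords Y_set (chart \<kappa>)" for i j
    by (simp add: frame_def sub_reg_Y_coord sub_open_chart)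
  have m: "(\<lambda>r. matrix_inv (frame \<kappa> r) $ i $ j) \<in> sub_reg Y_coords Y_set (chart \<kappa>)" for i j
    by (rule sub_reg_matrix_inv[OF f sub_open_chart]) (simp add: chart_def invertible_det_nz)
  have "(\<lambda>r. (\<Sum>l\<in>UNIV. matrix_inv (frame \<kappa> r) $ i $ l * r $ i $ l $ k) - matrix_inv (frame \<kappa> r) $ i $ k)
      \<in> sub_reg Y_coords Y_set (chart \<kappa>)" for i k
    by (intro sub_reg_diff sub_reg_sum sub_reg_mult m sub_reg_Y_coord sub_open_chart)
  then have s: "(\<lambda>r. snd (local_section \<kappa> r) $ i $ k) \<in> sub_reg Y_coords Y_set (chart \<kappa>)" for i k
    by (simp add: local_section_def matrix_matrix_mult_def)
  fix c :: "'a cmat \<times> 'a cmat \<Rightarrow> complex" assume "c \<in> pair_coords"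
  then show "c \<circ> local_section \<kappa> \<in> sub_reg Y_coords Y_set (chart \<kappa>)"
    using f s by (auto simp: pair_coords_def o_def local_section_def)
qed

text \<open>The image is written as a union of charts so that its openness is immediate;
  \<open>phi_rep_image\<close> identifies it as the image.\<close>

abbreviation phi_image :: "('n::finite cmat^'n) set"
  where "phi_image \<equiv> \<Union>\<kappa>. chart \<kappa>"

section \<open>Passage to the torus quotient and the inverse of \<open>phi\<close>\<close>

lemma topo_mu_T_zero_variety [simp]:
  "topo mu_T_zero_variety = subtopology (zariski pair_coords) mu_T_zero"
  by (simp add: mu_T_zero_variety_def)

lemma topo_Y_variety [simp]: "topo Y_variety = subtopology (zariski Y_coords) Y_set"
  by (simp add: Y_variety_def)

lemma points_cotangent_X: "points cotangent_X = torus_orbit ` mu_T_zero"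
  by (simp add: cotangent_X_def points_quotient_space)

lemma openin_phi_image: "openin (topo Y_variety) phi_image"
  using sub_open_chart by auto

lemma phi_image: "phi ` points cotangent_X = phi_image"
  by (simp add: points_cotangent_X image_image phi_torus_orbit phi_rep_image)

lemma morphism_phi_rep: "morphism mu_T_zero_variety Y_variety phi_rep"
proof -
  note r = regular_map_phi_rep
  have "phi_rep ` mu_T_zero \<subseteq> Y_set" using phi_rep_in_Y by blast
  then show ?thesis
    using regular_map_continuous[OF r] regular_map_comp[OF r]
    by (auto simp: morphism_def continuous_map_def mu_T_zero_variety_def Y_variety_def)
qed

text \<open>The universal property of the quotient: its open sets and regular functions are defined
  by pulling back along \<open>\<pi>\<close>, so each condition on \<open>f\<close> becomes the same
  condition on \<open>h\<close>.\<close>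

lemma morphism_from_quotient:
  assumes h: "morphism (subvariety X S) N h" and f: "\<And>x. x \<in> S \<Longrightarrow> f (\<pi> x) = h x"
  shows "morphism (quotient_space (subvariety X S) \<pi>) N f"
proof -
  let ?M = "subvariety X S"
  let ?Q = "quotient_space ?M \<pi>"
  have pts: "points ?Q = \<pi> ` S" by (simp add: points_quotient_space)
  have pre: "{x \<in> points ?M. \<pi> x \<in> {q \<in> points ?Q. f q \<in> V}} = {x \<in> points ?M. h x \<in> V}" for V
  proof -
    have "\<pi> x \<in> {q \<in> points ?Q. f q \<in> V} \<longleftrightarrow> h x \<in> V" if "x \<in> S" for x
      unfolding pts using that by (simp add: f[OF that])
    then show ?thesis by auto
  qed
  have hc: "continuous_map (topo ?M) (topo N) h"
    and hr: "\<And>V k. openin (topo N) V \<Longrightarrow> k \<in> reg N V \<Longrightarrow> k \<circ> h \<in> reg ?M {x \<in> points ?M. h x \<in> V}"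
    using h unfolding morphism_def by blast+
  show ?thesis
    unfolding morphism_def
  proof (intro conjI allI impI)
    show "continuous_map (topo ?Q) (topo N) f"
      unfolding continuous_map_def
    proof (intro conjI allI impI)
      show "f \<in> points ?Q \<rightarrow> points N"
        using hc by (auto simp: pts f continuous_map_def)
      fix V assume "openin (topo N) V"
      then have "openin (topo ?M) {x \<in> points ?M. h x \<in> V}"
        using hc unfolding continuous_map_def by blast
      then show "openin (topo ?Q) {q \<in> points ?Q. f q \<in> V}"
        unfolding openin_quotient_space pre by (auto simp: pts)
    qed
    fix V k assume "openin (topo N) V \<and> k \<in> reg N V"
    then have "k \<circ> h \<in> reg ?M {x \<in> points ?M. h x \<in> V}" using hr by blast
    then have "k \<circ> f \<circ> \<pi> \<in> reg ?M {x \<in> points ?M. h x \<in> V}"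
      by (rule sub_reg_cong) (simp add: f)
    then show "k \<circ> f \<in> reg ?Q {q \<in> points ?Q. f q \<in> V}"
      unfolding pre[symmetric] by (simp add: quotient_space_def)
  qed
qed

lemma morphism_phi: "morphism cotangent_X Y_variety phi"
  unfolding cotangent_X_def mu_T_zero_variety_def
  by (rule morphism_from_quotient[OF morphism_phi_rep[unfolded mu_T_zero_variety_def]])
    (rule phi_torus_orbit)

lemma morphism_into_open_subspace:
  assumes f: "morphism M N f" and W: "openin (topo N) W" "f ` points M \<subseteq> W"
  shows "morphism M (open_subspace N W) f"
proof -
  have "continuous_map (topo M) (subtopology (topo N) W) f"
    using f W(2) by (auto simp: morphism_def continuous_map_in_subtopology)
  moreover have "openin (topo N) V" if "openin (subtopology (topo N) W) V" for V
    using that W(1) by (rule openin_trans_full)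
  ultimately show ?thesis
    using f by (simp add: morphism_def open_subspace_def)
qed

text \<open>Choosing a representative globally removes any gluing of charts: by
  \<open>torus_orbit_eq\<close> the orbit does not depend on the choice, so every local section
  computes the same map.\<close>

definition phi_inverse :: "'n::finite cmat^'n \<Rightarrow> ('n cmat \<times> 'n cmat) set"
  where "phi_inverse r = torus_orbit (SOME x. x \<in> mu_T_zero \<and> phi_rep x = r)"

lemma phi_inverse_phi_rep:
  assumes "x \<in> mu_T_zero"
  shows "phi_inverse (phi_rep x) = torus_orbit x"
proof -
  define y where "y = (SOME y. y \<in> mu_T_zero \<and> phi_rep y = phi_rep x)"
  have "y \<in> mu_T_zero \<and> phi_rep y = phi_rep x"
    unfolding y_def by (rule someI[of _ x]) (simp add: assms)
  then show ?thesis
    unfolding phi_inverse_def y_def[symmetric] using torus_orbit_eq assms by blast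
qed

lemma phi_inverse_chart:
  assumes "r \<in> chart \<kappa>"
  shows "phi_inverse r = torus_orbit (local_section \<kappa> r)"
  using phi_inverse_phi_rep[OF local_section(1)[OF assms]] by (simp add: local_section(2)[OF assms])

text \<open>On \<open>chart \<kappa>\<close> the map is the local section followed by the projection
  to orbits. Preimages of open sets and pullbacks of regular functions are thus controlled chart by
  chart, and the pieces \<open>Q V \<kappa>\<close> are glued.\<close>

lemma morphism_phi_inverse:
  "morphism (open_subspace Y_variety phi_image)
    (cotangent_X :: ('n::finite cmat \<times> 'n cmat) set fspace) phi_inverse"
proof -
  let ?Y = "open_subspace Y_variety phi_image :: ('n cmat^'n) fspace"
  have pts: "points ?Y = phi_image"
    using openin_subset[OF openin_phi_image] by (auto simp: open_subspace_def)
  define P where "P V = {x \<in> mu_T_zero. torus_orbit x \<in> V}" for V :: "('n cmat \<times> 'n cmat) set set"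
  define Q where "Q V \<kappa> = {r \<in> chart \<kappa>. local_section \<kappa> r \<in> P V}" for V \<kappa>
  have Q: "{r \<in> points ?Y. phi_inverse r \<in> V} = (\<Union>\<kappa>. Q V \<kappa>)" for V
    unfolding pts Q_def P_def using phi_inverse_chart local_section(1) by fastforce
  have oP: "sub_open pair_coords mu_T_zero (P V)" if "openin (topo cotangent_X) V" for V :: "('n cmat \<times> 'n cmat) set set"
    using that by (simp add: cotangent_X_def openin_quotient_space P_def)
  have oQ: "sub_open Y_coords Y_set (Q V \<kappa>)" if "openin (topo cotangent_X) V" for V :: "('n cmat \<times> 'n cmat) set set" and \<kappa>
    unfolding Q_def by (rule regular_map_continuous[OF regular_map_local_section oP[OF that]])
  show ?thesis
    unfolding morphism_def
  proof (intro conjI allI impI)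
    show "continuous_map (topo ?Y) (topo cotangent_X) phi_inverse"
      unfolding continuous_map_def
    proof (intro conjI allI impI)
      show "phi_inverse \<in> points ?Y \<rightarrow> points cotangent_X"
        unfolding pts points_cotangent_X using phi_inverse_chart local_section(1) by fastforce
      fix V :: "('n cmat \<times> 'n cmat) set set" assume V: "openin (topo cotangent_X) V"
      have "openin (topo Y_variety) (\<Union>\<kappa>. Q V \<kappa>)" using oQ[OF V] by auto
      moreover have "(\<Union>\<kappa>. Q V \<kappa>) \<subseteq> phi_image" by (auto simp: Q_def)
      ultimately show "openin (topo ?Y) {r \<in> points ?Y. phi_inverse r \<in> V}"
        unfolding Q by (simp add: open_subspace_def openin_open_subtopology[OF openin_phi_image[simplified]])
    qed
    fix V :: "('n cmat \<times> 'n cmat) set set" and h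
    assume "openin (topo cotangent_X) V \<and> h \<in> reg cotangent_X V"
    then have V: "openin (topo cotangent_X) V"
      and h: "h \<circ> torus_orbit \<in> sub_reg pair_coords mu_T_zero (P V)"
      by (simp_all add: cotangent_X_def quotient_space_def mu_T_zero_variety_def P_def)
    have "h \<circ> phi_inverse \<in> sub_reg Y_coords Y_set (\<Union>\<kappa>. Q V \<kappa>)"
    proof (rule sub_reg_local)
      fix r assume "r \<in> (\<Union>\<kappa>. Q V \<kappa>)"
      then obtain \<kappa> where r: "r \<in> Q V \<kappa>" by blast
      have "h \<circ> torus_orbit \<circ> local_section \<kappa> \<in> sub_reg Y_coords Y_set (Q V \<kappa>)"
        unfolding Q_def by (rule regular_map_comp[OF regular_map_local_section h])
      then have "h \<circ> phi_inverse \<in> sub_reg Y_coords Y_set (Q V \<kappa>)"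
        by (rule sub_reg_cong) (simp add: Q_def phi_inverse_chart[of _ \<kappa>])
      with r show "\<exists>U. r \<in> U \<and> U \<subseteq> (\<Union>\<kappa>. Q V \<kappa>) \<and> h \<circ> phi_inverse \<in> sub_reg Y_coords Y_set U"
        by blast
    qed
    then show "h \<circ> phi_inverse \<in> reg ?Y {r \<in> points ?Y. phi_inverse r \<in> V}"
      unfolding Q by (simp add: open_subspace_def Y_variety_def)
  qed
qed

lemma open_embedding_phi: "open_embedding cotangent_X Y_variety phi"
  unfolding open_embedding_def phi_image isomorphism_def
proof (intro conjI exI[of _ phi_inverse] ballI)
  show "openin (topo Y_variety) phi_image" by (rule openin_phi_image)
  show "morphism cotangent_X (open_subspace Y_variety phi_image) phi"
    by (rule morphism_into_open_subspace[OF morphism_phi openin_phi_image]) (simp add: phi_image)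
  show "morphism (open_subspace Y_variety phi_image) cotangent_X phi_inverse"
    by (rule morphism_phi_inverse)
  show "phi_inverse (phi q) = q" if "q \<in> points cotangent_X" for q
    using that by (auto simp: points_cotangent_X phi_torus_orbit phi_inverse_phi_rep)
  fix r assume "r \<in> points (open_subspace Y_variety phi_image)"
  then have "r \<in> phi_image" by (auto simp: open_subspace_def)
  then obtain x where "x \<in> mu_T_zero" "r = phi_rep x"
    unfolding phi_rep_image[symmetric] by blast
  then show "phi (phi_inverse r) = r" by (simp add: phi_inverse_phi_rep phi_torus_orbit)
qed

section \<open>The symplectic forms\<close>

lemma coord_germs:
  assumes "x \<in> mu_T_zero"
  shows "(\<lambda>y. fst y $ i $ j) \<in> germs mu_T_zero_variety x"
    "(\<lambda>y. snd y $ i $ j) \<in> germs mu_T_zero_variety x"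
    "(\<lambda>y. coframe y $ i $ j) \<in> germs mu_T_zero_variety x"
    "(\<lambda>y. matrix_inv (fst y) $ i $ j) \<in> germs mu_T_zero_variety x"
proof -
  have germ: "f \<in> germs mu_T_zero_variety x" if "f \<in> sub_reg pair_coords mu_T_zero mu_T_zero" for f
    unfolding mu_T_zero_variety_def by (rule germs_subvarietyI[OF sub_open_self assms that])
  show "(\<lambda>y. fst y $ i $ j) \<in> germs mu_T_zero_variety x"
    "(\<lambda>y. snd y $ i $ j) \<in> germs mu_T_zero_variety x"
    "(\<lambda>y. coframe y $ i $ j) \<in> germs mu_T_zero_variety x"
    by (intro germ sub_reg_pair_coord sub_reg_coframe sub_open_self)+
  show "(\<lambda>y. matrix_inv (fst y) $ i $ j) \<in> germs mu_T_zero_variety x"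
    by (intro germ sub_reg_matrix_inv sub_reg_pair_coord sub_open_self) (simp add: mu_T_zero_iff)
qed

lemma matrix_d_cong:
  assumes "D \<in> tangent (subvariety X S) x" "x \<in> S" "\<And>y. y \<in> S \<Longrightarrow> F y = H y"
    and "\<And>i j. (\<lambda>y. F y $ i $ j) \<in> germs (subvariety X S) x"
    and "\<And>i j. (\<lambda>y. H y $ i $ j) \<in> germs (subvariety X S) x"
  shows "matrix_d F D = matrix_d H D"
proof -
  have "D (\<lambda>y. F y $ i $ j) = D (\<lambda>y. H y $ i $ j)" for i j
    by (rule tangent_cong[OF assms(1,4,5) _ assms(2)]) (simp_all add: sub_open_self assms(3))
  then show ?thesis by (simp add: matrix_d_def)
qed

text \<open>Differentiating \<open>g^-1 g = 1\<close> gives \<open>d(g^-1) = - g^-1 dg g^-1\<close>;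
  the summand \<open>A\<close> of the coframe contributes \<open>dA\<close>.\<close>

lemma matrix_d_coframe:
  assumes x: "x \<in> mu_T_zero" and D: "D \<in> tangent mu_T_zero_variety x"
  shows "matrix_d coframe D =
    matrix_d snd D - matrix_inv (fst x) ** matrix_d fst D ** matrix_inv (fst x)"
proof -
  note D' = D[unfolded mu_T_zero_variety_def]
  note cg = coord_germs[OF x, unfolded mu_T_zero_variety_def]
  let ?I = "\<lambda>y. matrix_inv (fst y)"
  have inv: "invertible (fst x)" using x by (simp add: mu_T_zero_iff)
  have g1: "(\<lambda>y. (?I y ** fst y) $ i $ j) \<in> germs (subvariety pair_coords mu_T_zero) x" for i j
    unfolding matrix_matrix_mult_def vec_lambda_beta by (intro germs_sum germs_mult cg x)
  \<comment> \<open>The product is the identity only where \<open>fst y\<close> is invertible, so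
    this is an equality of germs and not of total functions.\<close>
  have "matrix_d (\<lambda>y. ?I y ** fst y) D = matrix_d (\<lambda>_. mat 1) D"
    by (rule matrix_d_cong[OF D' x _ g1 germs_const[OF x]]) (simp add: matrix_inv_props mu_T_zero_iff)
  also have "\<dots> = 0" by (simp add: matrix_d_def tangent_const[OF D' x] vec_eq_iff)
  finally have "matrix_d ?I D ** fst x + ?I x ** matrix_d fst D = 0"
    using matrix_d_mult[OF D' x cg(4) cg(1)] by simp
  then have "matrix_d ?I D ** fst x = - (?I x ** matrix_d fst D)"
    by (simp add: eq_neg_iff_add_eq_0)
  then have "matrix_d ?I D ** (fst x ** ?I x) = - (?I x ** matrix_d fst D) ** ?I x"
    by (simp add: matrix_mul_assoc)
  moreover have "- A ** B = - (A ** B)" for A B :: "'a cmat"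
    by (simp add: vec_eq_iff matrix_matrix_mult_def sum_negf)
  ultimately have "matrix_d ?I D = - (?I x ** matrix_d fst D ** ?I x)"
    by (simp add: matrix_inv_props inv)
  moreover have "matrix_d coframe D = matrix_d ?I D + matrix_d snd D"
    by (simp add: vec_eq_iff matrix_d_def coframe_def tangent_add[OF D' cg(4) cg(2)])
  ultimately show ?thesis by simp
qed

text \<open>The derivative of the constraint \<open>b_i u_i = 1\<close>. Here tangency to the zero
  level of the moment map enters.\<close>

lemma pairing_matrix_d:
  assumes x: "x \<in> mu_T_zero" and D: "D \<in> tangent mu_T_zero_variety x"
  shows "pairing (coframe x $ i) (column i (matrix_d fst D))
    = - pairing (matrix_d coframe D $ i) (column i (fst x))"
proof -
  note D' = D[unfolded mu_T_zero_variety_def]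
  note cg = coord_germs[OF x, unfolded mu_T_zero_variety_def]
  have g1: "(\<lambda>y. (coframe y ** fst y) $ i $ i) \<in> germs (subvariety pair_coords mu_T_zero) x"
    unfolding matrix_matrix_mult_def vec_lambda_beta by (intro germs_sum germs_mult cg x)
  have "D (\<lambda>y. (coframe y ** fst y) $ i $ i) = D (\<lambda>_. 1)"
    by (rule tangent_cong[OF D' g1 germs_const[OF x] _ x])
      (simp_all add: sub_open_self coframe_mult_entry)
  then have "matrix_d (\<lambda>y. coframe y ** fst y) D $ i $ i = 0"
    by (simp add: matrix_d_def tangent_const[OF D' x])
  then have "(matrix_d coframe D ** fst x) $ i $ i + (coframe x ** matrix_d fst D) $ i $ i = 0"
    by (simp add: matrix_d_mult[OF D' x cg(3) cg(1)])
  then show ?thesis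
    by (simp add: pairing_def column_def matrix_matrix_mult_def eq_neg_iff_add_eq_0 add.commute)
qed

text \<open>The Leibniz rule for the factorisation:
  \<open>dr_i = du_i b_i + u_i db_i\<close>.\<close>

lemma matrix_d_pushforward_phi_rep:
  assumes x: "x \<in> mu_T_zero" and D: "D \<in> tangent mu_T_zero_variety x"
  shows "matrix_d (\<lambda>s. s $ i) (pushforward Y_variety phi_rep x D) =
    outer (column i (matrix_d fst D)) (coframe x $ i) +
    outer (column i (fst x)) (matrix_d coframe D $ i)"
proof -
  note D' = D[unfolded mu_T_zero_variety_def]
  note cg = coord_germs[OF x, unfolded mu_T_zero_variety_def]
  have "pushforward Y_variety phi_rep x D (\<lambda>s. s $ i $ j $ k) =
      D (\<lambda>y. fst y $ j $ i) * coframe x $ i $ k + fst x $ j $ i * D (\<lambda>y. coframe y $ i $ k)" for j k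
  proof -
    have Y: "(\<lambda>s. s $ i $ j $ k) \<in> germs Y_variety (phi_rep x)"
      unfolding Y_variety_def
      by (rule germs_subvarietyI[OF sub_open_self phi_rep_in_Y[OF x] sub_reg_Y_coord[OF sub_open_self]])
    have "(\<lambda>s. s $ i $ j $ k) \<circ> phi_rep \<in> germs mu_T_zero_variety x"
      by (rule morphism_at_germs[OF morphism_at_morphism[OF morphism_phi_rep] Y]) (simp add: x)
    then have "D ((\<lambda>s. s $ i $ j $ k) \<circ> phi_rep) = D (\<lambda>y. fst y $ j $ i * coframe y $ i $ k)"
      unfolding mu_T_zero_variety_def
      by (rule tangent_cong[OF D' _ germs_mult[OF cg(1,3)] _ x])
        (simp_all add: sub_open_self phi_rep_entry mu_T_zero_iff)
    also have "\<dots> = D (\<lambda>y. fst y $ j $ i) * coframe x $ i $ k + fst x $ j $ i * D (\<lambda>y. coframe y $ i $ k)"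
      by (simp add: tangent_mult[OF D' cg(1,3)])
    finally show ?thesis by (simp add: pushforward_apply[where f = phi_rep, OF Y])
  qed
  then show ?thesis by (simp add: vec_eq_iff matrix_d_def column_def)
qed

text \<open>The trace of \<open>r r1 r2\<close> for \<open>r = u b\<close> and variations
  \<open>u1 b + u b1\<close>, \<open>u2 b + u b2\<close>. Of the four terms of the expansion one is
  \<open>b1 u2\<close>; by the constraints the others are \<open>(b1 u)(b2 u)\<close> up to sign,
  with signs adding up to one copy.\<close>

lemma trace_outer_variation:
  assumes "pairing b u = 1" "pairing b u1 = - pairing b1 u" "pairing b u2 = - pairing b2 u"
  shows "trace (outer u b ** ((outer u1 b + outer u b1) ** (outer u2 b + outer u b2)))
    = pairing b1 u2 + pairing b1 u * pairing b2 u"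
  using assms
  by (simp add: matrix_add_ldistrib matrix_add_rdistrib outer_mult trace_add trace_outer
      pairing_scale pairing_minus algebra_simps)

lemma omega_Y_phi_rep:
  assumes x: "x \<in> mu_T_zero"
    and D: "D \<in> tangent mu_T_zero_variety x" and E: "E \<in> tangent mu_T_zero_variety x"
  shows "omega_Y (phi_rep x) (pushforward Y_variety phi_rep x D) (pushforward Y_variety phi_rep x E)
    = omega_GL x D E"
proof -
  have inv: "invertible (fst x)" using x by (simp add: mu_T_zero_iff)
  let ?push = "pushforward Y_variety phi_rep x"
  let ?w = "\<lambda>D E. \<Sum>i\<in>UNIV. pairing (matrix_d coframe D $ i) (column i (matrix_d fst E))"
  \<comment> \<open>The extra product in \<open>trace_outer_variation\<close> is symmetric in the
    two variations, so it cancels in the wedge.\<close>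
  have one: "trace (phi_rep x $ i ** matrix_wedge (\<lambda>s. s $ i) (\<lambda>s. s $ i) (?push D) (?push E))
      = pairing (matrix_d coframe D $ i) (column i (matrix_d fst E))
        - pairing (matrix_d coframe E $ i) (column i (matrix_d fst D))" for i
  proof -
    have sub: "A ** (B - C) = A ** B - A ** C" for A B C :: "'a cmat"
      by (simp add: vec_eq_iff matrix_matrix_mult_def right_diff_distrib sum_subtractf)
    note v = trace_outer_variation[OF pairing_coframe[OF x]]
    show ?thesis
      unfolding matrix_wedge_def matrix_d_pushforward_phi_rep[OF x D]
        matrix_d_pushforward_phi_rep[OF x E] phi_rep_eq_outer[OF inv] sub trace_sub
        v[OF pairing_matrix_d[OF x D] pairing_matrix_d[OF x E]]
        v[OF pairing_matrix_d[OF x E] pairing_matrix_d[OF x D]]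
      by simp
  qed
  have w: "?w D E = trace (matrix_d coframe D ** matrix_d fst E)" for D E
    by (simp add: pairing_def column_def trace_def matrix_matrix_mult_def)
  have trace_sum: "trace (sum f I) = (\<Sum>i\<in>I. trace (f i))" for f :: "'a \<Rightarrow> 'a cmat" and I
    by (simp add: trace_def sum.swap[of _ I])
  have "omega_Y (phi_rep x) (?push D) (?push E) = ?w D E - ?w E D"
    unfolding omega_Y_def trace_sum one by (simp add: sum_subtractf)
  also have "\<dots> = trace (matrix_d snd D ** matrix_d fst E) - trace (matrix_d snd E ** matrix_d fst D)"
  proof -
    let ?g = "matrix_inv (fst x)"
    have sub: "(A - B) ** C = A ** C - B ** C" for A B C :: "'a cmat"
      by (simp add: vec_eq_iff matrix_matrix_mult_def left_diff_distrib sum_subtractf)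
    \<comment> \<open>This is what the \<open>g^-1\<close> part of the coframe contributes. By
      cyclicity it is symmetric in \<open>D\<close> and \<open>E\<close> and disappears from the
      difference.\<close>
    have "trace (?g ** matrix_d fst D ** ?g ** matrix_d fst E)
        = trace ((?g ** matrix_d fst D) ** (?g ** matrix_d fst E))"
      by (simp only: matrix_mul_assoc)
    also have "\<dots> = trace ((?g ** matrix_d fst E) ** (?g ** matrix_d fst D))"
      by (rule trace_mul_sym)
    also have "\<dots> = trace (?g ** matrix_d fst E ** ?g ** matrix_d fst D)"
      by (simp only: matrix_mul_assoc)
    finally show ?thesis
      unfolding w unfolding matrix_d_coframe[OF x D] matrix_d_coframe[OF x E] sub trace_sub by simp
  qed
  finally show ?thesis by (simp add: omega_GL_def matrix_wedge_def trace_sub)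
qed

section \<open>Descent of the forms to the quotient\<close>

lemma pushforward_phi:
  assumes x: "x \<in> mu_T_zero"
  shows "pushforward Y_variety phi (torus_orbit x) (pushforward cotangent_X torus_orbit x D) =
    pushforward Y_variety (phi \<circ> torus_orbit) x D"
  by (rule pushforward_comp, rule morphism_at_morphism[OF morphism_phi])
    (simp add: points_cotangent_X x)

lemma morphism_torus_orbit: "morphism mu_T_zero_variety cotangent_X torus_orbit"
  unfolding cotangent_X_def by (rule morphism_quotient_space)

text \<open>By the chain rule the pullback along \<open>phi\<close> is computed by
  \<open>phi \<circ> torus_orbit\<close>, which agrees with \<open>phi_rep\<close> on all of
  \<open>mu_T_zero\<close>. Consequently \<open>omega_GL\<close> takes the same value on any two
  lifts of the same pair of vectors.\<close>

lemma omega_Y_pushforward_phi: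
  assumes x: "x \<in> mu_T_zero"
    and D: "D \<in> tangent mu_T_zero_variety x" and E: "E \<in> tangent mu_T_zero_variety x"
  shows "pullback_form Y_variety phi omega_Y (torus_orbit x)
      (pushforward cotangent_X torus_orbit x D) (pushforward cotangent_X torus_orbit x E)
    = omega_GL x D E"
proof -
  have c: "morphism_at mu_T_zero_variety Y_variety phi_rep x"
    by (rule morphism_at_morphism[OF morphism_phi_rep]) (simp add: x)
  have c': "morphism_at mu_T_zero_variety Y_variety (phi \<circ> torus_orbit) x"
    by (rule morphism_at_comp[OF morphism_at_morphism[OF morphism_torus_orbit]
          morphism_at_morphism[OF morphism_phi]])
      (simp_all add: x points_cotangent_X)
  have "pushforward Y_variety (phi \<circ> torus_orbit) x D' = pushforward Y_variety phi_rep x D'"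
    if "D' \<in> tangent mu_T_zero_variety x" for D'
    by (rule pushforward_cong[OF that c' c, of mu_T_zero])
      (simp_all add: sub_open_self x phi_torus_orbit)
  then show ?thesis
    by (simp add: pullback_form_def pushforward_phi[OF x] D E phi_torus_orbit[OF x] omega_Y_phi_rep[OF x D E])
qed

text \<open>Tangent vectors of the quotient lift, because the local sections of \<open>phi\<close> split the projection.\<close>

lemma tangent_lift:
  assumes q: "q \<in> points cotangent_X"
  shows "\<exists>x\<in>mu_T_zero. torus_orbit x = q \<and>
    (\<forall>D\<in>tangent cotangent_X q. \<exists>D'\<in>tangent mu_T_zero_variety x.
       pushforward cotangent_X torus_orbit x D' = D)"
proof -
  have "phi q \<in> phi_image" using q phi_image by blast
  then obtain \<kappa> where \<kappa>: "phi q \<in> chart \<kappa>" by blast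
  let ?f = "local_section \<kappa> \<circ> phi"
  \<comment> \<open>The representative depends on \<open>q\<close> alone, so two tangent vectors at
    \<open>q\<close> can be lifted at the same point.\<close>
  define x where "x = ?f q"
  have x: "x \<in> mu_T_zero" using local_section(1)[OF \<kappa>] by (simp add: x_def)
  \<comment> \<open>The section value and any representative of \<open>y\<close> have the same image
    under \<open>phi_rep\<close>, hence the same orbit.\<close>
  have split: "torus_orbit (?f y) = y" if y: "y \<in> points cotangent_X" "phi y \<in> chart \<kappa>" for y
  proof -
    obtain z where z: "z \<in> mu_T_zero" "y = torus_orbit z"
      using y(1) unfolding points_cotangent_X by blast
    then show ?thesis
      using torus_orbit_eq[OF local_section(1)[OF y(2)] z(1)] local_section(2)[OF y(2)]
      by (simp add: phi_torus_orbit)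
  qed
  have qx: "torus_orbit x = q" unfolding x_def by (rule split[OF q \<kappa>])
  have phi_at: "morphism_at cotangent_X Y_variety phi q"
    by (rule morphism_at_morphism[OF morphism_phi q])
  have f: "morphism_at cotangent_X mu_T_zero_variety ?f q"
    using phi_at morphism_at_regular_map[OF regular_map_local_section \<kappa>]
    unfolding mu_T_zero_variety_def Y_variety_def by (rule morphism_at_comp)
  have \<pi>: "morphism_at mu_T_zero_variety cotangent_X torus_orbit (?f q)"
    by (rule morphism_at_morphism[OF morphism_torus_orbit]) (use x in \<open>simp add: x_def\<close>)
  have \<pi>f: "morphism_at cotangent_X cotangent_X (torus_orbit \<circ> ?f) q"
    by (rule morphism_at_comp[OF f \<pi>])
  have id: "morphism_at cotangent_X cotangent_X id q"
    unfolding morphism_at_def by auto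
  have "openin (topo Y_variety) (chart \<kappa>)" by (simp add: sub_open_chart)
  from phi_at this \<kappa> obtain U where U: "openin (topo cotangent_X) U" "q \<in> U" "phi ` U \<subseteq> chart \<kappa>"
    by (rule morphism_at_open)
  have "\<exists>D'\<in>tangent mu_T_zero_variety x. pushforward cotangent_X torus_orbit x D' = D"
    if D: "D \<in> tangent cotangent_X q" for D
  proof
    show "pushforward mu_T_zero_variety ?f q D \<in> tangent mu_T_zero_variety x"
      unfolding x_def using pushforward_tangent[OF D f[unfolded mu_T_zero_variety_def]]
      by (simp only: mu_T_zero_variety_def)
    have "pushforward cotangent_X torus_orbit (?f q) (pushforward mu_T_zero_variety ?f q D)
        = pushforward cotangent_X (torus_orbit \<circ> ?f) q D"
      by (rule pushforward_comp[where f = ?f and x = q, OF \<pi>])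
    also have "\<dots> = pushforward cotangent_X id q D"
    \<comment> \<open>The composite is known to be the identity on \<open>U\<close>, which
      \<open>phi\<close> maps into the chart; agreement near \<open>q\<close> suffices.\<close>
    proof (rule pushforward_cong[OF D \<pi>f id U(1,2)])
      fix y assume y: "y \<in> U"
      then have "y \<in> points cotangent_X" using openin_subset[OF U(1)] by blast
      with y U(3) split[of y] show "(torus_orbit \<circ> ?f) y = id y" by auto
    qed
    also have "\<dots> = D" by (rule pushforward_id[OF D])
    finally show "pushforward cotangent_X torus_orbit x (pushforward mu_T_zero_variety ?f q D) = D"
      by (simp only: x_def)
  qed
  with x qx show ?thesis by blast
qed

text \<open>This settles the definite description in \<open>induced_form\<close>. A value exists
  because tangent vectors lift, and it is unique because every pair of lifts yields the pullback of
  \<open>omega_Y\<close>; the induced form is thus well defined and equal to the pullback at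
  once.\<close>

lemma omega_X_eq_pullback:
  assumes q: "q \<in> points cotangent_X"
    and D: "D \<in> tangent cotangent_X q" and E: "E \<in> tangent cotangent_X q"
  shows "omega_X q D E = pullback_form Y_variety phi omega_Y q D E"
  unfolding omega_X_def induced_form_def cotangent_X_def[symmetric]
proof (rule the_equality)
  obtain x where x: "x \<in> mu_T_zero" "torus_orbit x = q"
    and lift: "\<And>D. D \<in> tangent cotangent_X q \<Longrightarrow>
      \<exists>D'\<in>tangent mu_T_zero_variety x. pushforward cotangent_X torus_orbit x D' = D"
    using tangent_lift[OF q] by blast
  obtain D' E' where
    "D' \<in> tangent mu_T_zero_variety x" "pushforward cotangent_X torus_orbit x D' = D"
    "E' \<in> tangent mu_T_zero_variety x" "pushforward cotangent_X torus_orbit x E' = E"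
    using lift[OF D] lift[OF E] by blast
  with x omega_Y_pushforward_phi[of x D' E']
  show "\<exists>m\<in>points mu_T_zero_variety. \<exists>D'\<in>tangent mu_T_zero_variety m.
      \<exists>E'\<in>tangent mu_T_zero_variety m. torus_orbit m = q \<and>
      pushforward cotangent_X torus_orbit m D' = D \<and> pushforward cotangent_X torus_orbit m E' = E \<and>
      pullback_form Y_variety phi omega_Y q D E = omega_GL m D' E'"
    by (intro bexI[of _ x] bexI[of _ D'] bexI[of _ E']) auto
next
  fix c
  assume "\<exists>m\<in>points mu_T_zero_variety. \<exists>D'\<in>tangent mu_T_zero_variety m.
      \<exists>E'\<in>tangent mu_T_zero_variety m. torus_orbit m = q \<and>
      pushforward cotangent_X torus_orbit m D' = D \<and> pushforward cotangent_X torus_orbit m E' = E \<and>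
      c = omega_GL m D' E'"
  then obtain m D' E' where "m \<in> mu_T_zero"
    "D' \<in> tangent mu_T_zero_variety m" "E' \<in> tangent mu_T_zero_variety m"
    and eqs: "torus_orbit m = q" "pushforward cotangent_X torus_orbit m D' = D"
      "pushforward cotangent_X torus_orbit m E' = E" and c: "c = omega_GL m D' E'"
    by (elim bexE conjE) simp
  then show "c = pullback_form Y_variety phi omega_Y q D E"
    using omega_Y_pushforward_phi[of m D' E'] unfolding eqs c by simp
qed

theorem theorem7:
  shows "open_symplectic_embedding
    (cotangent_X :: ('n::finite cmat \<times> 'n cmat) set fspace) omega_X
    (Y_variety :: ('n cmat^'n) fspace) omega_Y
    phi"
  unfolding open_symplectic_embedding_def
  using open_embedding_phi omega_X_eq_pullback by metis

end
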